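(* Let $J$ be the monic Jacobi matrix associated with a nonrational function $F\in\mathbf N_{-\infty}$, and let $J=LU$ be its block $LU$-factorization. Then the matrix $\mathfrak J=UL$ is the monic generalized Jacobi matrix associated with the function $\lambda F(\lambda)+s_0\in\mathbf D^-_{-\infty}$.
   Context: $\lambda\widehat\to\infty$ means that $\lambda\to\infty$ inside a sector $\varepsilon<\arg\lambda<\pi-\varepsilon$, $\varepsilon>0$. $\mathbf N$ is the class of Nevanlinna functions (analytic in $\mathbb C_+$, mapping $\mathbb C_+$ into $\mathbb C_+$). $\mathbf N_{-\infty}$ is the set of $F\in\mathbf N$ for which there are real $s_0,s_1,\dots$ with $F(\lambda)=-\frac{s_0}{\lambda}-\dots-\frac{s_{2n}}{\lambda^{2n+1}}+o(\lambda^{-2n-1})$, $\lambda\widehat\to\infty$, for every $n\in\mathbb Z_+$ (written $F(\lambda)\sim-\sum_j s_j\lambda^{-j-1}$); equivalently $F(\lambda)=\int_{\mathbb R}\frac{d\sigma(t)}{t-\lambda}$ with a finite measure $\sigma$ with moments $s_j=\int t^jd\sigma(t)$. Let $P_j$ be the monic orthogonal polynomials of $\sigma/s_0$: $\lambda P_j=P_{j+1}+b_jP_j+c_{j-1}P_{j-1}$, $P_{-1}=0$, $P_0=1$, $b_j\in\mathbb R$, $c_j>0$. The monic Jacobi matrix $J$ associated with $F$ is the semi-infinite tridiagonal matrix with $J_{j,j}=b_j$, $J_{j,j+1}=1$, $J_{j+1,j}=c_j$. $\mathbf D^-_{-\infty}$: functions $\mathfrak F$ meromorphic in $\mathbb C_+$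 such that for some $\mathfrak s_{-1}\in\mathbb R\setminus\{0\}$ one has $-\frac{\mathfrak s_{-1}}{\lambda}+\frac{\mathfrak F(\lambda)}{\lambda}\in\mathbf N_{-\infty}$. $\mathbf D^+_{-\infty}$: functions $\mathfrak F$ meromorphic in $\mathbb C_+$ with $\mathfrak F(\lambda)\sim-\sum_{j\ge0}\mathfrak s_j\lambda^{-j-1}$, $\mathfrak s_j\in\mathbb R$, and $\lambda\mathfrak F(\lambda)+\mathfrak s_0\in\mathbf N_{-\infty}$. Normal indices of a real sequence $\{\mathfrak s_j\}_{j\ge0}$: the integers $n\ge1$ with $\det(\mathfrak s_{i+k})_{i,k=0}^{n-1}\neq0$, listed increasingly $\mathfrak n_1<\mathfrak n_2<\cdots$; $\mathfrak n_0=0$, $\mathfrak k_j=\mathfrak n_{j+1}-\mathfrak n_j$ (always $\mathfrak k_j\in\{1,2\}$ here). Generalized Jacobi matrix: let $\mathfrak F\in\mathbf D^\pm_{-\infty}$ be nonrational with $\mathfrak F\sim-\sum\mathfrak s_j\lambda^{-j-1}$. It is normalized if its first nonzero coefficient $\mathfrak s_{\mathfrak n_1-1}$ has modulus $1$. For normalized $\mathfrak F$ put $\mathfrak F_0=\mathfrak F$ and define recursively $-1/\mathfrak F_j(\lambda)=\epsilon_j\mathfrak p_j(\lambda)+\mathfrak b_j^2\mathfrak F_{j+1}(\lambda)$, where $\epsilon_j=\pm1$ is the first nonzero asymptotic coefficient of $\mathfrak F_j$, $\mathfrak p_j$ is the monic polynomial (of degree $\mathfrak k_j$) for which $-1/\mathfrak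 F_j-\epsilon_j\mathfrak p_j=o(1)$ as $\lambda\widehat\to\infty$, and $\mathfrak b_j>0$ is such that $\mathfrak F_{j+1}$ is normalized. Put $\mathfrak c_j=\epsilon_j\epsilon_{j+1}\mathfrak b_j^2$; write $\mathfrak p_j(\lambda)=\lambda+\mathfrak p_0^{(j)}$ if $\mathfrak k_j=1$ and $\mathfrak p_j(\lambda)=\lambda^2+\mathfrak p_1^{(j)}\lambda+\mathfrak p_0^{(j)}$ if $\mathfrak k_j=2$. The monic generalized Jacobi matrix associated with $\mathfrak F$ is the block tridiagonal matrix with diagonal blocks $\mathfrak B_j=-\mathfrak p_0^{(j)}$ if $\mathfrak k_j=1$, $\mathfrak B_j=\begin{pmatrix}0&1\\-\mathfrak p_0^{(j)}&-\mathfrak p_1^{(j)}\end{pmatrix}$ if $\mathfrak k_j=2$, superdiagonal blocks $\mathfrak D_j$ ($\mathfrak k_j\times\mathfrak k_{j+1}$, lower-left entry $1$, other entries $0$) and subdiagonal blocks $\mathfrak C_j$ ($\mathfrak k_{j+1}\times\mathfrak k_j$, lower-left entry $\mathfrak c_j$, other entries $0$). If $\mathfrak F$ is not normalized, the matrix associated with $\mathfrak F$ is by definition the one associated with $\mathfrak F/|\mathfrak s_{\mathfrak n_1-1}|$. Block $LU$-factorization of $J$: let $\{\mathfrak n_j\}_{j\ge1}$ be the normal indices of $\{s_{j+1}\}_{j\ge0}$, $\mathfrak n_0=0$, and $\mathfrak k_j=\mathfrak n_{j+1}-\mathfrak n_j$, $j\in\mathbb Z_+$. Then $J=LU$ for unique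 block matrices of the following form: $L$ has identity diagonal blocks $I_{\mathfrak k_j}$, subdiagonal blocks $L_{j+1}$ ($\mathfrak k_{j+1}\times\mathfrak k_j$, upper-left entry $l_{j+1}$, other entries $0$), and zeros elsewhere; $U$ has diagonal blocks $U_j=u_0^{(j)}$ if $\mathfrak k_j=1$, $U_j=\begin{pmatrix}0&1\\ u_0^{(j)}&u_1^{(j)}\end{pmatrix}$ if $\mathfrak k_j=2$, superdiagonal blocks $D_j$ ($\mathfrak k_j\times\mathfrak k_{j+1}$, lower-left entry $1$, other entries $0$), and zeros elsewhere. *)

theory Defs
  imports
    "HOL-Complex_Analysis.Complex_Analysis"
    "HOL-Library.Landau_Symbols"
    "HOL-Library.Groups_Big_Fun"
    "Jordan_Normal_Form.Determinant"
begin

abbreviation upper_half_plane :: "complex set" where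
  "upper_half_plane \<equiv> {z. Im z > 0}"

text \<open>An assertion holds eventually along this filter iff for every positive \<open>\<epsilon>\<close> it holds for
  all sufficiently large \<open>z\<close> in the sector \<open>\<epsilon> < Arg z < pi - \<epsilon>\<close>; the bound on \<open>|z|\<close> may depend
  on \<open>\<epsilon>\<close>.\<close>

definition sector_infinity :: "complex filter" where
  "sector_infinity =
     (SUP \<epsilon>\<in>{0<..}. inf at_infinity (principal {z. \<epsilon> < Arg z \<and> Arg z < pi - \<epsilon>}))"

definition asymptotic_series :: "(complex \<Rightarrow> complex) \<Rightarrow> (nat \<Rightarrow> real) \<Rightarrow> bool" where
  "asymptotic_series f s \<longleftrightarrow>
     (\<forall>n. (\<lambda>z. f z - (\<Sum>j\<le>2*n. - of_real (s j) / z ^ (j + 1)))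
            \<in> o[sector_infinity](\<lambda>z. 1 / z ^ (2*n + 1)))"

definition nevanlinna :: "(complex \<Rightarrow> complex) set" where
  "nevanlinna = {F. F holomorphic_on upper_half_plane \<and> F ` upper_half_plane \<subseteq> upper_half_plane}"

definition nevanlinna_inf :: "(complex \<Rightarrow> complex) set" where
  "nevanlinna_inf = {F \<in> nevanlinna. \<exists>s. asymptotic_series F s}"

definition D_minus :: "(complex \<Rightarrow> complex) set" where
  "D_minus = {f. f meromorphic_on upper_half_plane \<and>
     (\<exists>r::real. r \<noteq> 0 \<and> (\<lambda>z. - of_real r / z + f z / z) \<in> nevanlinna_inf)}"

definition D_plus :: "(complex \<Rightarrow> complex) set" where
  "D_plus = {f. f meromorphic_on upper_half_plane \<and>
     (\<exists>s. asymptotic_series f s \<and> (\<lambda>z. z * f z + of_real (s 0)) \<in> nevanlinna_inf)}"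

text \<open>Identities between meromorphic functions on the upper half-plane are required off a set
  without accumulation points there, as the values of a HOL function at its poles are
  meaningless.\<close>

definition rational_function :: "(complex \<Rightarrow> complex) \<Rightarrow> bool" where
  "rational_function f \<longleftrightarrow>
     (\<exists>p q. q \<noteq> 0 \<and> (\<forall>\<^sub>\<approx>z\<in>upper_half_plane. f z = poly p z / poly q z))"

definition stieltjes_measure :: "(complex \<Rightarrow> complex) \<Rightarrow> (nat \<Rightarrow> real) \<Rightarrow> real measure \<Rightarrow> bool" where
  "stieltjes_measure F s \<sigma> \<longleftrightarrow>
     sets \<sigma> = sets borel \<and> finite_measure \<sigma> \<and>
     (\<forall>j. integrable \<sigma> (\<lambda>t. t ^ j) \<and> s j = (LINT t|\<sigma>. t ^ j)) \<and>
     (\<forall>z\<in>upper_half_plane. F z = (LINT t|\<sigma>. 1 / (of_real t - z)))"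

definition monic_orthogonal_polynomials :: "real measure \<Rightarrow> (nat \<Rightarrow> real poly) \<Rightarrow> bool" where
  "monic_orthogonal_polynomials \<mu> P \<longleftrightarrow>
     (\<forall>j. Polynomial.degree (P j) = j \<and> lead_coeff (P j) = 1) \<and>
     (\<forall>i j. i \<noteq> j \<longrightarrow> (LINT t|\<mu>. poly (P i) t * poly (P j) t) = 0)"

definition monic_jacobi_matrix :: "(nat \<Rightarrow> real) \<Rightarrow> (nat \<Rightarrow> real) \<Rightarrow> nat \<Rightarrow> nat \<Rightarrow> real" where
  "monic_jacobi_matrix b c i j =
     (if i = j then b i else if j = i + 1 then 1 else if i = j + 1 then c j else 0)"

definition monic_jacobi_matrix_of :: "(complex \<Rightarrow> complex) \<Rightarrow> (nat \<Rightarrow> nat \<Rightarrow> real) \<Rightarrow> bool" where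
  "monic_jacobi_matrix_of F J \<longleftrightarrow>
     (\<exists>s \<sigma> P b c.
        asymptotic_series F s \<and> stieltjes_measure F s \<sigma> \<and>
        monic_orthogonal_polynomials (scale_measure (ennreal (1 / s 0)) \<sigma>) P \<and>
        (\<forall>j. c j > 0) \<and>
        (\<forall>j. [:0, 1:] * P j =
               P (j + 1) + Polynomial.smult (b j) (P j) +
               (if j = 0 then 0 else Polynomial.smult (c (j - 1)) (P (j - 1)))) \<and>
        J = monic_jacobi_matrix b c)"

definition hankel :: "(nat \<Rightarrow> real) \<Rightarrow> nat \<Rightarrow> real mat" where
  "hankel s n = mat n n (\<lambda>(i, k). s (i + k))"

text \<open>If only finitely many Hankel determinants are nonzero, the values past the last normal index
  are meaningless; this does not happen for the nonrational functions considered here.\<close>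

definition normal_index :: "(nat \<Rightarrow> real) \<Rightarrow> nat \<Rightarrow> nat" where
  "normal_index s j =
     (if j = 0 then 0 else enumerate {n. n \<ge> 1 \<and> Determinant.det (hankel s n) \<noteq> 0} (j - 1))"

text \<open>Block matrices are semi-infinite scalar matrices together with the block boundaries
  \<open>0 = n 0 < n 1 < \<dots>\<close>.\<close>

definition block_size :: "(nat \<Rightarrow> nat) \<Rightarrow> nat \<Rightarrow> nat" where
  "block_size n j = n (j + 1) - n j"

definition block :: "(nat \<Rightarrow> nat) \<Rightarrow> (nat \<Rightarrow> nat \<Rightarrow> real) \<Rightarrow> nat \<Rightarrow> nat \<Rightarrow> real mat" where
  "block n M i j = mat (block_size n i) (block_size n j) (\<lambda>(a, c). M (n i + a) (n j + c))"

text \<open>\<open>A j\<close>, \<open>B j\<close>, \<open>C j\<close> are the blocks in positions \<open>(j, j)\<close>, \<open>(j, j + 1)\<close>, \<open>(j + 1, j)\<close>.\<close>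

definition block_tridiagonal ::
  "(nat \<Rightarrow> nat) \<Rightarrow> (nat \<Rightarrow> real mat) \<Rightarrow> (nat \<Rightarrow> real mat) \<Rightarrow> (nat \<Rightarrow> real mat) \<Rightarrow>
   (nat \<Rightarrow> nat \<Rightarrow> real) \<Rightarrow> bool" where
  "block_tridiagonal n A B C M \<longleftrightarrow>
     (\<forall>i j. block n M i j =
        (if i = j then A j else if j = i + 1 then B i else if i = j + 1 then C j
         else 0\<^sub>m (block_size n i) (block_size n j)))"

definition upper_left :: "nat \<Rightarrow> nat \<Rightarrow> real \<Rightarrow> real mat" where
  "upper_left r m x = mat r m (\<lambda>(a, c). if a = 0 \<and> c = 0 then x else 0)"

definition lower_left :: "nat \<Rightarrow> nat \<Rightarrow> real \<Rightarrow> real mat" where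
  "lower_left r m x = mat r m (\<lambda>(a, c). if a = r - 1 \<and> c = 0 then x else 0)"

text \<open>For \<open>k = 1\<close> this is the number \<open>v 0\<close>; for \<open>k = 2\<close> it has the rows \<open>(0, 1)\<close> and
  \<open>(v 0, v 1)\<close>. Larger blocks do not occur.\<close>

definition companion_block :: "nat \<Rightarrow> (nat \<Rightarrow> real) \<Rightarrow> real mat" where
  "companion_block k v =
     mat k k (\<lambda>(a, c). if a = k - 1 then v c else if c = a + 1 then 1 else 0)"

text \<open>\<open>Sum_any\<close> is the sum over the finitely many nonzero terms; it is only used for \<open>M\<close> having
  finitely many nonzero entries in each row.\<close>

definition inf_mat_mult ::
  "(nat \<Rightarrow> nat \<Rightarrow> real) \<Rightarrow> (nat \<Rightarrow> nat \<Rightarrow> real) \<Rightarrow> nat \<Rightarrow> nat \<Rightarrow> real" where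
  "inf_mat_mult M N i j = Sum_any (\<lambda>k. M i k * N k j)"

definition block_LU_factorization ::
  "(nat \<Rightarrow> nat) \<Rightarrow> (nat \<Rightarrow> nat \<Rightarrow> real) \<Rightarrow> (nat \<Rightarrow> nat \<Rightarrow> real) \<Rightarrow> (nat \<Rightarrow> nat \<Rightarrow> real) \<Rightarrow> bool" where
  "block_LU_factorization n J L U \<longleftrightarrow>
     (let k = block_size n in
      (\<exists>l. block_tridiagonal n (\<lambda>j. 1\<^sub>m (k j)) (\<lambda>j. 0\<^sub>m (k j) (k (j + 1)))
             (\<lambda>j. upper_left (k (j + 1)) (k j) (l (j + 1))) L) \<and>
      (\<exists>u. block_tridiagonal n (\<lambda>j. companion_block (k j) (u j))
             (\<lambda>j. lower_left (k j) (k (j + 1)) 1) (\<lambda>j. 0\<^sub>m (k (j + 1)) (k j)) U) \<and>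
      J = inf_mat_mult L U)"

definition first_coeff :: "(nat \<Rightarrow> real) \<Rightarrow> real" where
  "first_coeff s = s (LEAST j. s j \<noteq> 0)"

text \<open>In the recursion below, \<open>S j\<close> is the coefficient sequence of the asymptotic expansion of
  \<open>f j\<close>. The condition that its first nonzero term have modulus one says that \<open>f j\<close> is
  normalized.\<close>

definition normalized_gen_jacobi_matrix_of ::
  "(complex \<Rightarrow> complex) \<Rightarrow> (nat \<Rightarrow> nat \<Rightarrow> real) \<Rightarrow> bool" where
  "normalized_gen_jacobi_matrix_of g M \<longleftrightarrow>
     (\<exists>(f :: nat \<Rightarrow> complex \<Rightarrow> complex) S \<epsilon> (p :: nat \<Rightarrow> real poly) b.
        let n = normal_index (S 0); k = block_size n in
        f 0 = g \<and>
        (\<forall>j. f j meromorphic_on upper_half_plane \<and>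
             asymptotic_series (f j) (S j) \<and> \<epsilon> j = first_coeff (S j) \<and> \<bar>\<epsilon> j\<bar> = 1 \<and>
             Polynomial.degree (p j) = k j \<and> lead_coeff (p j) = 1 \<and>
             ((\<lambda>z. - 1 / f j z - of_real (\<epsilon> j) * poly (map_poly of_real (p j)) z) \<longlongrightarrow> 0)
                sector_infinity \<and>
             b j > 0 \<and>
             (\<forall>\<^sub>\<approx>z\<in>upper_half_plane.
                - 1 / f j z = of_real (\<epsilon> j) * poly (map_poly of_real (p j)) z
                              + of_real ((b j)\<^sup>2) * f (j + 1) z)) \<and>
        block_tridiagonal n
          (\<lambda>j. companion_block (k j) (\<lambda>i. - poly.coeff (p j) i))
          (\<lambda>j. lower_left (k j) (k (j + 1)) 1)
          (\<lambda>j. lower_left (k (j + 1)) (k j) (\<epsilon> j * \<epsilon> (j + 1) * (b j)\<^sup>2))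
          M)"

definition gen_jacobi_matrix_of :: "(complex \<Rightarrow> complex) \<Rightarrow> (nat \<Rightarrow> nat \<Rightarrow> real) \<Rightarrow> bool" where
  "gen_jacobi_matrix_of f M \<longleftrightarrow>
     f \<in> D_minus \<union> D_plus \<and> \<not> rational_function f \<and>
     (\<exists>s. asymptotic_series f s \<and>
          normalized_gen_jacobi_matrix_of (\<lambda>z. f z / of_real \<bar>first_coeff s\<bar>) M)"

end

(* The functions of the second kind Q_m satisfy J Q = z Q + s_0 e_0. Put R = U Q; then
   L R = z Q + s_0 e_0 and therefore U L R = z R + s_0 U e_0, with R_0 = z F + s_0. Eliminating the
   inner component of each block of size 2 leaves a three-term recurrence
   p_j r_j = r_(j+1) + c_(j-1) r_(j-1) for the first components r_j of the blocks of R, so that the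
   normalized ratios of consecutive r_j form the continued fraction of z F + s_0. The orthogonality of
   the P_m determines the order of each r_j at infinity, whence the degrees and signs in that
   continued fraction. The positivity of the entries c_m of J = L U forces block sizes 1 or 2 and
   nonzero entries c_j of U L. There are infinitely many normal indices because consecutive P_m have
   no common zero at 0. *)
theory Submission
  imports Defs
begin

section \<open>Asymptotic expansions in a sector\<close>

text \<open>Unlike \<open>asymptotic_series\<close>, this allows a constant term and truncates at every order,
  so that the functions with an expansion correspond to power series in \<open>1 / z\<close> compatibly with
  sums, products and inverses.\<close>

definition expands :: "(complex \<Rightarrow> complex) \<Rightarrow> real fps \<Rightarrow> bool" where
  "expands f a \<longleftrightarrow>
     (\<forall>N. (\<lambda>z. f z - (\<Sum>i<N. of_real (fps_nth a i) / z ^ i)) \<in> O[sector_infinity](\<lambda>z. 1 / z ^ N))"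

lemma sector_infinity_le: "sector_infinity \<le> at_infinity"
  unfolding sector_infinity_def by (auto intro!: SUP_least)

lemma sector_infinity_neq_bot: "sector_infinity \<noteq> bot"
proof
  assume "sector_infinity = bot"
  then have "eventually (\<lambda>_. False) sector_infinity"
    by simp
  then have "eventually (\<lambda>_. False) (inf at_infinity (principal {z. (1::real) < Arg z \<and> Arg z < pi - 1}))"
    unfolding sector_infinity_def eventually_Sup by auto
  then obtain b :: real where b: "\<And>z::complex. b \<le> norm z \<Longrightarrow> \<not> (1 < Arg z \<and> Arg z < pi - 1)"
    unfolding eventually_inf_principal eventually_at_infinity by auto
  define z where "z = complex_of_real (\<bar>b\<bar> + 1) * \<i>"
  have "Arg z = Arg \<i>"
    unfolding z_def by (rule Arg_times_of_real) auto
  then have "Arg z = pi / 2" by simp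
  moreover have "norm z = \<bar>b\<bar> + 1"
    unfolding z_def by (simp add: norm_mult)
  ultimately have "b \<le> norm z" "1 < Arg z" "Arg z < pi - 1"
    using pi_gt3 by linarith+
  then show False
    using b[of z] by blast
qed

lemma eventually_norm_ge: "eventually (\<lambda>z. r \<le> norm z) sector_infinity"
  using sector_infinity_le by (auto simp: le_filter_def eventually_at_infinity)

lemma eventually_neq_0: "eventually (\<lambda>z::complex. z \<noteq> 0) sector_infinity"
  using eventually_norm_ge[of 1] by eventually_elim auto

lemma inverse_power_bigo:
  assumes "M \<le> N"
  shows "(\<lambda>z::complex. 1 / z ^ N) \<in> O[sector_infinity](\<lambda>z. 1 / z ^ M)"
proof (rule bigoI[where c = 1])
  show "eventually (\<lambda>z::complex. norm (1 / z ^ N) \<le> 1 * norm (1 / z ^ M)) sector_infinity"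
    using eventually_norm_ge[of 1]
  proof eventually_elim
    case (elim z)
    then have "0 < norm z ^ M" "norm z ^ M \<le> norm z ^ N"
      using assms by (auto intro!: power_increasing zero_less_power simp del: zero_less_norm_iff)
    then show ?case
      by (simp add: norm_divide norm_power frac_le)
  qed
qed

lemma inverse_power_smallo:
  assumes "M < N"
  shows "(\<lambda>z::complex. 1 / z ^ N) \<in> o[sector_infinity](\<lambda>z. 1 / z ^ M)"
proof -
  have "((\<lambda>z::complex. inverse z) \<longlongrightarrow> 0) sector_infinity"
    using sector_infinity_le tendsto_inverse_0 tendsto_mono by blast
  then have "(\<lambda>z::complex. 1 / z) \<in> o[sector_infinity](\<lambda>_. 1)"
    by (intro smalloI_tendsto) (auto simp: field_simps)
  then have "(\<lambda>z::complex. 1 / z ^ M * (1 / z)) \<in> o[sector_infinity](\<lambda>z. 1 / z ^ M * 1)"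
    by (rule landau_o.small.mult_left)
  then have "(\<lambda>z::complex. 1 / z ^ Suc M) \<in> o[sector_infinity](\<lambda>z. 1 / z ^ M)"
    by (simp add: mult.commute)
  moreover have "(\<lambda>z::complex. 1 / z ^ N) \<in> O[sector_infinity](\<lambda>z. 1 / z ^ Suc M)"
    by (rule inverse_power_bigo) (use assms in auto)
  ultimately show ?thesis
    using landau_o.big_small_trans by blast
qed

lemma sum_inverse_power_bigo:
  assumes "\<And>i. i \<in> A \<Longrightarrow> N \<le> e i"
  shows "(\<lambda>z::complex. \<Sum>i\<in>A. c i / z ^ e i) \<in> O[sector_infinity](\<lambda>z. 1 / z ^ N)"
proof (rule big_sum_in_bigo)
  fix i assume "i \<in> A"
  then have "(\<lambda>z::complex. c i * (1 / z ^ e i)) \<in> O[sector_infinity](\<lambda>z. 1 / z ^ N)"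
    by (cases "c i = 0") (simp_all add: inverse_power_bigo assms del: times_divide_eq_right)
  then show "(\<lambda>z::complex. c i / z ^ e i) \<in> O[sector_infinity](\<lambda>z. 1 / z ^ N)"
    by simp
qed

lemma expandsI_shifted:
  assumes "\<And>N. \<exists>M\<ge>N. (\<lambda>z. f z - (\<Sum>i<M. of_real (fps_nth a i) / z ^ i)) \<in> O[sector_infinity](\<lambda>z. 1 / z ^ N)"
  shows "expands f a"
  unfolding expands_def
proof
  fix N
  obtain M where M: "M \<ge> N"
    "(\<lambda>z. f z - (\<Sum>i<M. of_real (fps_nth a i) / z ^ i)) \<in> O[sector_infinity](\<lambda>z. 1 / z ^ N)"
    using assms by blast
  have "(\<lambda>z. (f z - (\<Sum>i<M. of_real (fps_nth a i) / z ^ i)) + (\<Sum>i\<in>{N..<M}. of_real (fps_nth a i) / z ^ i))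
      \<in> O[sector_infinity](\<lambda>z. 1 / z ^ N)"
    by (rule sum_in_bigo(1)[OF M(2) sum_inverse_power_bigo]) auto
  moreover have "(\<Sum>i<M. of_real (fps_nth a i) / z ^ i) =
      (\<Sum>i<N. of_real (fps_nth a i) / z ^ i) + (\<Sum>i\<in>{N..<M}. of_real (fps_nth a i) / z ^ i)" for z :: complex
    using sum.atLeastLessThan_concat[of 0 N M "\<lambda>i. of_real (fps_nth a i) / z ^ i"] M(1)
    by (simp add: lessThan_atLeast0)
  ultimately show "(\<lambda>z. f z - (\<Sum>i<N. of_real (fps_nth a i) / z ^ i)) \<in> O[sector_infinity](\<lambda>z. 1 / z ^ N)"
    by (simp add: algebra_simps)
qed

lemma asymptotic_series_iff_expands:
  "asymptotic_series f s \<longleftrightarrow> expands f (- (fps_X * Abs_fps s))"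
proof -
  have eq: "(\<Sum>i<2*n+2. of_real (fps_nth (- (fps_X * Abs_fps s)) i) / z ^ i) =
     (\<Sum>j\<le>2*n. - of_real (s j) / z ^ (j + 1))" for n and z :: complex
    by (simp add: sum.lessThan_Suc_shift lessThan_Suc_atMost[symmetric] del: sum.lessThan_Suc power_Suc)
  show ?thesis
  proof
    assume *: "asymptotic_series f s"
    show "expands f (- (fps_X * Abs_fps s))"
    proof (rule expandsI_shifted)
      fix N
      have "(\<lambda>z. f z - (\<Sum>i<2*N+2. of_real (fps_nth (- (fps_X * Abs_fps s)) i) / z ^ i))
        \<in> O[sector_infinity](\<lambda>z. 1 / z ^ (2*N+1))"
        unfolding eq using * landau_o.small_imp_big unfolding asymptotic_series_def by blast
      also have "(\<lambda>z::complex. 1 / z ^ (2*N+1)) \<in> O[sector_infinity](\<lambda>z. 1 / z ^ N)"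
        by (rule inverse_power_bigo) auto
      finally show "\<exists>M\<ge>N. (\<lambda>z. f z - (\<Sum>i<M. of_real (fps_nth (- (fps_X * Abs_fps s)) i) / z ^ i))
        \<in> O[sector_infinity](\<lambda>z. 1 / z ^ N)"
        by (intro exI[of _ "2*N+2"]) auto
    qed
  next
    assume *: "expands f (- (fps_X * Abs_fps s))"
    show "asymptotic_series f s"
      unfolding asymptotic_series_def
    proof
      fix n
      have "(\<lambda>z. f z - (\<Sum>j\<le>2*n. - of_real (s j) / z ^ (j + 1))) \<in> O[sector_infinity](\<lambda>z. 1 / z ^ (2*n+2))"
        unfolding eq[symmetric] using * unfolding expands_def by blast
      moreover have "(\<lambda>z::complex. 1 / z ^ (2*n+2)) \<in> o[sector_infinity](\<lambda>z. 1 / z ^ (2*n+1))"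
        by (rule inverse_power_smallo) auto
      ultimately show "(\<lambda>z. f z - (\<Sum>j\<le>2*n. - of_real (s j) / z ^ (j + 1))) \<in> o[sector_infinity](\<lambda>z. 1 / z ^ (2*n+1))"
        using landau_o.big_small_trans by blast
    qed
  qed
qed

lemma expands_add:
  assumes "expands f a" "expands g b"
  shows "expands (\<lambda>z. f z + g z) (a + b)"
  unfolding expands_def
proof
  fix N
  have "(\<lambda>z. (f z - (\<Sum>i<N. of_real (fps_nth a i) / z ^ i)) + (g z - (\<Sum>i<N. of_real (fps_nth b i) / z ^ i)))
     \<in> O[sector_infinity](\<lambda>z. 1 / z ^ N)"
    using assms unfolding expands_def by (intro sum_in_bigo(1)) auto
  then show "(\<lambda>z. f z + g z - (\<Sum>i<N. of_real (fps_nth (a + b) i) / z ^ i)) \<in> O[sector_infinity](\<lambda>z. 1 / z ^ N)"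
    by (simp add: algebra_simps sum.distrib add_divide_distrib)
qed

lemma expands_const: "expands (\<lambda>_. of_real c) (fps_const c)"
proof (rule expandsI_shifted)
  fix N
  have "(\<Sum>i<Suc N. of_real (fps_nth (fps_const c) i) / z ^ i) = of_real c" for z :: complex
    by (subst sum.lessThan_Suc_shift) simp
  then show "\<exists>M\<ge>N. (\<lambda>z. of_real c - (\<Sum>i<M. of_real (fps_nth (fps_const c) i) / z ^ i))
      \<in> O[sector_infinity](\<lambda>z. 1 / z ^ N)"
    by (intro exI[of _ "Suc N"]) auto
qed

lemma truncated_product_bigo:
  fixes a b :: "real fps"
  shows "(\<lambda>z. (\<Sum>i<N. of_real (fps_nth a i) / z ^ i) * (\<Sum>i<N. of_real (fps_nth b i) / z ^ i)
     - (\<Sum>i<N. of_real (fps_nth (a * b) i) / z ^ i)) \<in> O[sector_infinity](\<lambda>z::complex. 1 / z ^ N)"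
proof -
  define t where "t = (\<lambda>(z::complex) (i,j). of_real (fps_nth a i * fps_nth b j) / z ^ (i + j))"
  have prod: "(\<Sum>i<N. of_real (fps_nth a i) / z ^ i) * (\<Sum>i<N. of_real (fps_nth b i) / z ^ i)
     = sum (t z) ({..<N} \<times> {..<N})" for z
    by (simp add: sum_product sum.cartesian_product t_def power_add)
  have "(\<Sum>i<N. of_real (fps_nth (a * b) i) / z ^ i) = (\<Sum>k<N. \<Sum>i\<le>k. t z (i, k - i))" for z
    by (simp add: fps_mult_nth t_def sum_divide_distrib atLeast0AtMost)
  also have "\<dots> z = sum (t z) {(i,j). i + j < N}" for z
    using sum.triangle_reindex[of "\<lambda>i j. t z (i, j)" N] by (simp add: case_prod_unfold)
  finally have low: "(\<Sum>i<N. of_real (fps_nth (a * b) i) / z ^ i) = sum (t z) {(i,j). i + j < N}" for z .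
  have "sum (t z) ({..<N} \<times> {..<N}) - sum (t z) {(i,j). i + j < N}
     = sum (t z) ({..<N} \<times> {..<N} - {(i,j). i + j < N})" for z
    by (rule sum_diff[symmetric]) auto
  also have "\<dots> z = (\<Sum>p\<in>{..<N} \<times> {..<N} - {(i,j). i + j < N}.
      of_real (fps_nth a (fst p) * fps_nth b (snd p)) / z ^ (fst p + snd p))" for z
    by (simp add: t_def case_prod_unfold)
  finally show ?thesis
    unfolding prod low by (simp only:) (rule sum_inverse_power_bigo, auto)
qed

lemma expands_bounded:
  assumes "expands f a"
  shows "f \<in> O[sector_infinity](\<lambda>_. 1)"
  using assms[unfolded expands_def, rule_format, of 0] by simp

lemma expands_mult:
  assumes "expands f a" "expands g b"
  shows "expands (\<lambda>z. f z * g z) (a * b)"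
  unfolding expands_def
proof
  fix N
  define A where "A = (\<lambda>z::complex. \<Sum>i<N. of_real (fps_nth a i) / z ^ i)"
  define B where "B = (\<lambda>z::complex. \<Sum>i<N. of_real (fps_nth b i) / z ^ i)"
  have "(\<lambda>z. (f z - A z) * g z) \<in> O[sector_infinity](\<lambda>z. 1 / z ^ N * 1)"
    using assms(1)[unfolded expands_def] expands_bounded[OF assms(2)]
    unfolding A_def by (intro landau_o.big.mult) auto
  moreover have "A \<in> O[sector_infinity](\<lambda>_. 1)"
    using sum_inverse_power_bigo[of "{..<N}" 0] unfolding A_def by simp
  then have "(\<lambda>z. A z * (g z - B z)) \<in> O[sector_infinity](\<lambda>z. 1 * (1 / z ^ N))"
    using assms(2)[unfolded expands_def] unfolding B_def by (intro landau_o.big.mult) auto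
  ultimately have "(\<lambda>z. (f z - A z) * g z + A z * (g z - B z) +
      (A z * B z - (\<Sum>i<N. of_real (fps_nth (a * b) i) / z ^ i))) \<in> O[sector_infinity](\<lambda>z. 1 / z ^ N)"
    using truncated_product_bigo[where N = N and a = a and b = b] unfolding A_def B_def
    by (intro sum_in_bigo(1)) auto
  then show "(\<lambda>z. f z * g z - (\<Sum>i<N. of_real (fps_nth (a * b) i) / z ^ i)) \<in> O[sector_infinity](\<lambda>z. 1 / z ^ N)"
    by (simp add: algebra_simps)
qed

lemma expands_cmult: "expands f a \<Longrightarrow> expands (\<lambda>z. of_real c * f z) (fps_const c * a)"
  using expands_mult[OF expands_const[of c]] by blast

lemma expands_uminus: "expands f a \<Longrightarrow> expands (\<lambda>z. - f z) (- a)"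
  using expands_cmult[of f a "-1"] by (simp flip: fps_const_neg)

lemma expands_diff: "expands f a \<Longrightarrow> expands g b \<Longrightarrow> expands (\<lambda>z. f z - g z) (a - b)"
  using expands_add[of f a "\<lambda>z. - g z" "- b"] expands_uminus[of g b] by simp

lemma expands_tendsto:
  assumes "expands f a"
  shows "(f \<longlongrightarrow> of_real (fps_nth a 0)) sector_infinity"
proof -
  have "(\<lambda>z. f z - of_real (fps_nth a 0)) \<in> O[sector_infinity](\<lambda>z. 1 / z ^ 1)"
    using assms[unfolded expands_def, rule_format, of 1] by simp
  moreover have "(\<lambda>z::complex. 1 / z ^ 1) \<in> o[sector_infinity](\<lambda>z. 1 / z ^ 0)"
    by (rule inverse_power_smallo) simp
  ultimately have "(\<lambda>z. f z - of_real (fps_nth a 0)) \<in> o[sector_infinity](\<lambda>z. 1 / z ^ 0)"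
    by (rule landau_o.big_small_trans)
  then have "((\<lambda>z. f z - of_real (fps_nth a 0)) \<longlongrightarrow> 0) sector_infinity"
    using smalloD_tendsto by fastforce
  then show ?thesis
    using LIM_zero_iff by blast
qed

lemma expands_eventually_neq_0:
  assumes "expands f a" "fps_nth a 0 \<noteq> 0"
  shows "eventually (\<lambda>z. f z \<noteq> 0) sector_infinity"
  using tendsto_imp_eventually_ne[OF expands_tendsto[OF assms(1)], of 0] assms(2) by simp

lemma expands_cong:
  assumes "eventually (\<lambda>z. f z = g z) sector_infinity"
  shows "expands f a \<longleftrightarrow> expands g a"
proof -
  have *: "expands g a" if "eventually (\<lambda>z. f z = g z) sector_infinity" "expands f a" for f g
    unfolding expands_def
  proof
    fix N
    have "eventually (\<lambda>z. g z - (\<Sum>i<N. of_real (fps_nth a i) / z ^ i) =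
       f z - (\<Sum>i<N. of_real (fps_nth a i) / z ^ i)) sector_infinity"
      using that(1) by eventually_elim simp
    then show "(\<lambda>z. g z - (\<Sum>i<N. of_real (fps_nth a i) / z ^ i)) \<in> O[sector_infinity](\<lambda>z. 1 / z ^ N)"
      using that(2) unfolding expands_def by (subst landau_o.big.in_cong) auto
  qed
  show ?thesis
    using *[of f g] *[of g f] assms by (auto simp: eq_commute)
qed

lemma expands_mult_z:
  assumes "expands f (fps_X * a)"
  shows "expands (\<lambda>z. z * f z) a"
  unfolding expands_def
proof
  fix N
  have "(\<Sum>i<Suc N. of_real (fps_nth (fps_X * a) i) / z ^ i) =
      (\<Sum>i<N. of_real (fps_nth a i) / z ^ Suc i)" for z :: complex
    by (subst sum.lessThan_Suc_shift) simp
  moreover have "z * (\<Sum>i<N. of_real (fps_nth a i) / z ^ Suc i) = (\<Sum>i<N. of_real (fps_nth a i) / z ^ i)"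
    if "z \<noteq> 0" for z :: complex
    using that by (simp add: sum_distrib_left)
  ultimately have eq: "eventually (\<lambda>z. z * f z - (\<Sum>i<N. of_real (fps_nth a i) / z ^ i) =
      z * (f z - (\<Sum>i<Suc N. of_real (fps_nth (fps_X * a) i) / z ^ i))) sector_infinity"
    using eventually_neq_0 by (auto elim!: eventually_mono simp del: sum.lessThan_Suc simp: right_diff_distrib)
  have "(\<lambda>z. z * (f z - (\<Sum>i<Suc N. of_real (fps_nth (fps_X * a) i) / z ^ i)))
     \<in> O[sector_infinity](\<lambda>z. z * (1 / z ^ Suc N))"
    using assms unfolding expands_def by (intro landau_o.big.mult_left) blast
  moreover have "O[sector_infinity](\<lambda>z::complex. z * (1 / z ^ Suc N)) = O[sector_infinity](\<lambda>z. 1 / z ^ N)"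
    by (rule landau_o.big.cong) (use eventually_neq_0 in \<open>eventually_elim, simp\<close>)
  ultimately have "(\<lambda>z. z * (f z - (\<Sum>i<Suc N. of_real (fps_nth (fps_X * a) i) / z ^ i)))
     \<in> O[sector_infinity](\<lambda>z. 1 / z ^ N)"
    by simp
  then show "(\<lambda>z. z * f z - (\<Sum>i<N. of_real (fps_nth a i) / z ^ i)) \<in> O[sector_infinity](\<lambda>z. 1 / z ^ N)"
    by (simp only: landau_o.big.in_cong[OF eq])
qed

lemma expands_mult_z_power:
  assumes "expands f (fps_X ^ m * a)"
  shows "expands (\<lambda>z. z ^ m * f z) a"
  using assms
proof (induction m arbitrary: f)
  case (Suc m)
  have "expands (\<lambda>z. z * f z) (fps_X ^ m * a)"
    using Suc.prems by (intro expands_mult_z) (simp add: mult.assoc)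
  from Suc.IH[OF this] show ?case
    by (simp add: mult.left_commute mult.assoc)
qed simp

lemma expands_inverse:
  assumes "expands f a" "fps_nth a 0 \<noteq> 0"
  shows "expands (\<lambda>z. 1 / f z) (inverse a)"
  unfolding expands_def
proof
  fix N
  define B where "B = (\<lambda>z::complex. \<Sum>i<N. of_real (fps_nth (inverse a) i) / z ^ i)"
  define A where "A = (\<lambda>z::complex. \<Sum>i<N. of_real (fps_nth a i) / z ^ i)"
  have "B \<in> O[sector_infinity](\<lambda>_. 1)"
    using sum_inverse_power_bigo[of "{..<N}" 0] unfolding B_def by simp
  then have 1: "(\<lambda>z. (f z - A z) * B z) \<in> O[sector_infinity](\<lambda>z. 1 / z ^ N * 1)"
    using assms(1)[unfolded expands_def] unfolding A_def by (intro landau_o.big.mult) auto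
  have 2: "(\<lambda>z. 1 - (\<Sum>i<N. of_real (fps_nth 1 i) / z ^ i)) \<in> O[sector_infinity](\<lambda>z. 1 / z ^ N)"
    using expands_const[of 1] unfolding expands_def by simp
  have 3: "(\<lambda>z. A z * B z - (\<Sum>i<N. of_real (fps_nth 1 i) / z ^ i)) \<in> O[sector_infinity](\<lambda>z. 1 / z ^ N)"
    using truncated_product_bigo[where N = N and a = a and b = "inverse a"] inverse_mult_eq_1'[OF assms(2)]
    unfolding A_def B_def by simp
  have "(\<lambda>z. (1 - (\<Sum>i<N. of_real (fps_nth 1 i) / z ^ i)) - (f z - A z) * B z
      - (A z * B z - (\<Sum>i<N. of_real (fps_nth 1 i) / z ^ i))) \<in> O[sector_infinity](\<lambda>z. 1 / z ^ N)"
    by (rule sum_in_bigo(2)[OF sum_in_bigo(2)[OF 2 1[unfolded mult_1_right]] 3])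
  then have num: "(\<lambda>z. 1 - f z * B z) \<in> O[sector_infinity](\<lambda>z. 1 / z ^ N)"
    by (simp add: algebra_simps)
  have "((\<lambda>z. 1 / f z) \<longlongrightarrow> 1 / of_real (fps_nth a 0)) sector_infinity"
    using assms(2) by (intro tendsto_intros expands_tendsto[OF assms(1)]) auto
  then have "(\<lambda>z. 1 / f z) \<in> O[sector_infinity](\<lambda>_. 1)"
    using sector_infinity_neq_bot by (intro bigoI_tendsto[where c = "1 / of_real (fps_nth a 0)"]) auto
  then have "(\<lambda>z. 1 / f z * (1 - f z * B z)) \<in> O[sector_infinity](\<lambda>z. 1 * (1 / z ^ N))"
    by (intro landau_o.big.mult num)
  moreover have eq: "eventually (\<lambda>z. 1 / f z * (1 - f z * B z) = 1 / f z - B z) sector_infinity"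
    using expands_eventually_neq_0[OF assms] by eventually_elim (simp add: field_simps)
  ultimately show "(\<lambda>z. 1 / f z - (\<Sum>i<N. of_real (fps_nth (inverse a) i) / z ^ i))
     \<in> O[sector_infinity](\<lambda>z. 1 / z ^ N)"
    by (simp only: landau_o.big.in_cong[OF eq] mult_1) (simp only: B_def)
qed

lemma expands_0_imp:
  assumes "expands (\<lambda>_. 0) a"
  shows "a = 0"
proof (rule ccontr)
  assume "a \<noteq> 0"
  then have "a = fps_X ^ subdegree a * unit_factor a"
    by (metis fps_shift_times_fps_X_power' fps_unit_factor_def mult.commute
        subdegree_decompose)
  then have "expands (\<lambda>z. z ^ subdegree a * 0) (unit_factor a)"
    using assms by (intro expands_mult_z_power) simp
  then have "((\<lambda>z. 0) \<longlongrightarrow> complex_of_real (fps_nth (unit_factor a) 0)) sector_infinity"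
    using expands_tendsto by force
  then have "fps_nth (unit_factor a) 0 = 0"
    using sector_infinity_neq_bot by (simp add: tendsto_const_iff)
  then show False
    using \<open>a \<noteq> 0\<close> by simp
qed

lemma expands_unique:
  assumes "expands f a" "expands f b"
  shows "a = b"
  using expands_0_imp[of "a - b"] expands_diff[OF assms] by simp

lemma asymptotic_series_unique:
  assumes "asymptotic_series f s" "asymptotic_series f t"
  shows "s = t"
proof -
  have "fps_X * Abs_fps s = fps_X * Abs_fps t"
    using expands_unique assms unfolding asymptotic_series_iff_expands by force
  then have "Abs_fps s = Abs_fps t" by simp
  then show ?thesis
    by (metis fps_nth_Abs_fps ext)
qed

section \<open>Orthogonal polynomials and normal indices\<close>

locale orthogonal_recurrence =
  fixes \<Lambda> :: "real poly \<Rightarrow> real" and P :: "nat \<Rightarrow> real poly" and b c :: "nat \<Rightarrow> real"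
  assumes functional_add: "\<Lambda> (p + r) = \<Lambda> p + \<Lambda> r"
    and functional_smult: "\<Lambda> (Polynomial.smult a p) = a * \<Lambda> p"
    and functional_1_pos: "\<Lambda> 1 > 0"
    and functional_P_Suc: "\<Lambda> (P (Suc m)) = 0"
    and degree_P: "Polynomial.degree (P m) = m"
    and monic_P: "lead_coeff (P m) = 1"
    and c_pos: "c m > 0"
    and recurrence: "[:0, 1:] * P m = P (Suc m) + Polynomial.smult (b m) (P m) +
           (if m = 0 then 0 else Polynomial.smult (c (m - 1)) (P (m - 1)))"
begin

definition mixed_moment :: "nat \<Rightarrow> nat \<Rightarrow> real" where
  "mixed_moment m i = \<Lambda> (Polynomial.monom 1 i * P m)"

lemma P_0: "P 0 = 1"
  using degree_P[of 0] monic_P[of 0] by (auto elim!: degree_eq_zeroE simp: one_pCons)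

lemma functional_0: "\<Lambda> 0 = 0"
  using functional_smult[of 0 0] by simp

lemma functional_sum: "\<Lambda> (\<Sum>x\<in>A. f x) = (\<Sum>x\<in>A. \<Lambda> (f x))"
  by (induction A rule: infinite_finite_induct) (auto simp: functional_0 functional_add)

lemma mixed_moment_Suc:
  "mixed_moment m (Suc i) = mixed_moment (Suc m) i + b m * mixed_moment m i +
     (if m = 0 then 0 else c (m - 1) * mixed_moment (m - 1) i)"
proof -
  have "Polynomial.monom 1 (Suc i) * P m = Polynomial.monom 1 i * ([:0, 1:] * P m)"
    by (simp add: monom_Suc)
  then show ?thesis
    unfolding mixed_moment_def recurrence
    by (simp add: distrib_left functional_add functional_smult functional_0 del: mult_pCons_left)
qed

lemma mixed_moment_0: "mixed_moment (Suc m) 0 = 0"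
  by (simp add: mixed_moment_def functional_P_Suc)

lemma mixed_moment_below: "i < m \<Longrightarrow> mixed_moment m i = 0"
proof (induction i arbitrary: m)
  case 0
  then show ?case by (cases m) (auto simp: mixed_moment_0)
next
  case (Suc i)
  then show ?case by (auto simp: mixed_moment_Suc)
qed

lemma mixed_moment_diag_Suc: "mixed_moment (Suc m) (Suc m) = c m * mixed_moment m m"
  by (simp add: mixed_moment_Suc[of "Suc m"] mixed_moment_below)

lemma mixed_moment_diag_pos: "mixed_moment m m > 0"
  by (induction m)
     (auto simp: mixed_moment_diag_Suc c_pos functional_1_pos P_0 mixed_moment_def[of 0])

lemma functional_mult: "\<Lambda> (w * r) = (\<Sum>i\<le>Polynomial.degree w. poly.coeff w i * \<Lambda> (Polynomial.monom 1 i * r))"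
proof -
  have monom: "Polynomial.monom a i * r = Polynomial.smult a (Polynomial.monom 1 i * r)" for a i
    using smult_monom[of a 1 i] mult_smult_left[of a "Polynomial.monom 1 i" r] by simp
  have "w * r = (\<Sum>i\<le>Polynomial.degree w. Polynomial.monom (poly.coeff w i) i) * r"
    by (simp add: poly_as_sum_of_monoms)
  also have "\<dots> = (\<Sum>i\<le>Polynomial.degree w. Polynomial.smult (poly.coeff w i) (Polynomial.monom 1 i * r))"
    unfolding sum_distrib_right by (intro sum.cong refl monom)
  finally show ?thesis
    by (simp add: functional_sum functional_smult)
qed

lemma orthogonal_eq_0:
  assumes "Polynomial.degree w < n" "\<And>i. i < n \<Longrightarrow> \<Lambda> (Polynomial.monom 1 i * w) = 0"
  shows "w = 0"
proof -
  define m where "m = Polynomial.degree w"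
  have "\<Lambda> (P m * w) = 0"
    using assms by (subst functional_mult, intro sum.neutral) (auto simp: degree_P m_def)
  moreover have "\<Lambda> (w * P m) = poly.coeff w m * mixed_moment m m"
    by (subst functional_mult, unfold m_def[symmetric] mixed_moment_def[symmetric], subst sum.remove[of _ m]) (auto intro!: sum.neutral simp: mixed_moment_below)
  ultimately have "poly.coeff w m = 0"
    using mixed_moment_diag_pos[of m] by (simp add: mult.commute)
  then show ?thesis by (simp add: m_def)
qed

lemma orthogonal_eq_smult_P:
  assumes "Polynomial.degree w \<le> n" "\<And>i. i < n \<Longrightarrow> \<Lambda> (Polynomial.monom 1 i * w) = 0"
  shows "w = Polynomial.smult (poly.coeff w n) (P n)"
proof (cases n)
  case 0
  then show ?thesis
    using assms(1) by (auto simp: P_0 elim!: degree_eq_zeroE)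
next
  case (Suc k)
  define w' where "w' = w + Polynomial.smult (- poly.coeff w n) (P n)"
  have "Polynomial.degree w' \<le> n"
    unfolding w'_def using assms(1)
    by (intro degree_add_le order_trans[OF degree_smult_le]) (simp_all add: degree_P)
  moreover have "poly.coeff w' n = 0"
    unfolding w'_def using monic_P[of n] by (simp add: degree_P)
  ultimately have "Polynomial.degree w' < n"
    using Suc by (metis leading_coeff_0_iff le_neq_implies_less degree_0 zero_less_Suc)
  moreover have "\<Lambda> (Polynomial.monom 1 i * w') = 0" if "i < n" for i
  proof -
    have "\<Lambda> (Polynomial.monom 1 i * P n) = 0"
      using mixed_moment_below[OF that] by (simp add: mixed_moment_def)
    then show ?thesis
      using assms(2)[OF that]
      by (simp only: w'_def distrib_left functional_add mult_smult_right functional_smult)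
  qed
  ultimately have "w' = 0"
    by (rule orthogonal_eq_0)
  then show ?thesis
    by (simp add: w'_def)
qed

text \<open>A kernel vector of the shifted Hankel matrix is the coefficient vector of some \<open>q\<close> such that
  \<open>t q(t)\<close> is orthogonal to all polynomials of degree less than \<open>n\<close>; hence \<open>t q(t)\<close> is a multiple
  of \<open>P n\<close>.\<close>

lemma P_at_0_of_singular_hankel:
  assumes "Determinant.det (hankel (\<lambda>i. \<Lambda> (Polynomial.monom 1 (i + 1))) n) = 0"
  shows "poly (P n) 0 = 0"
proof -
  define H where "H = hankel (\<lambda>i. \<Lambda> (Polynomial.monom 1 (i + 1))) n"
  have "H \<in> carrier_mat n n"
    by (simp add: H_def hankel_def)
  then obtain v where v: "v \<in> carrier_vec n" "v \<noteq> 0\<^sub>v n" "H *\<^sub>v v = 0\<^sub>v n"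
    using det_0_iff_vec_prod_zero[of H n] assms unfolding H_def by blast
  define w where "w = (\<Sum>k<n. Polynomial.monom (v $ k) (k + 1))"
  have coeff_w: "poly.coeff w (Suc k) = (if k < n then v $ k else 0)" for k
    unfolding w_def by (simp add: coeff_sum if_distrib cong: if_cong)
  have "poly.coeff w 0 = 0"
    unfolding w_def by (simp add: coeff_sum)
  have "Polynomial.degree w \<le> n"
    unfolding w_def by (intro degree_sum_le) (auto intro: order_trans[OF degree_monom_le])
  moreover have "\<Lambda> (Polynomial.monom 1 i * w) = 0" if "i < n" for i
  proof -
    have "Polynomial.monom 1 i * w = (\<Sum>k<n. Polynomial.smult (v $ k) (Polynomial.monom 1 (i + k + 1)))"
      unfolding w_def sum_distrib_left by (simp add: mult_monom smult_monom)
    then have "\<Lambda> (Polynomial.monom 1 i * w) = (H *\<^sub>v v) $ i"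
      using that v(1) unfolding H_def hankel_def
      by (simp add: functional_sum functional_smult scalar_prod_def lessThan_atLeast0 mult.commute)
    then show ?thesis
      using v(3) that by simp
  qed
  ultimately have eq: "w = Polynomial.smult (poly.coeff w n) (P n)"
    by (rule orthogonal_eq_smult_P)
  obtain k where "k < n" "v $ k \<noteq> 0"
    using v(1,2) by (metis carrier_vecD eq_vecI index_zero_vec)
  then have "poly.coeff w (Suc k) \<noteq> 0"
    by (simp add: coeff_w)
  then have "poly.coeff w n \<noteq> 0"
    using eq by (metis coeff_0 smult_0_left)
  moreover have "poly w 0 = poly.coeff w n * poly (P n) 0"
    by (subst eq) simp
  ultimately show ?thesis
    using \<open>poly.coeff w 0 = 0\<close> by (simp add: poly_0_coeff_0)
qed

lemma P_at_0_not_consecutive: "poly (P n) 0 \<noteq> 0 \<or> poly (P (Suc n)) 0 \<noteq> 0"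
proof (induction n)
  case 0
  then show ?case by (simp add: P_0)
next
  case (Suc n)
  have "poly ([:0, 1:] * P (Suc n)) 0 = 0" by simp
  then have "poly (P (Suc (Suc n))) 0 + b (Suc n) * poly (P (Suc n)) 0 + c n * poly (P n) 0 = 0"
    unfolding recurrence by simp
  then show ?case
    using Suc c_pos[of n] by (metis add_0 less_irrefl mult_eq_0_iff)
qed

lemma infinite_normal_indices:
  "infinite {n. n \<ge> 1 \<and> Determinant.det (hankel (\<lambda>i. \<Lambda> (Polynomial.monom 1 (i + 1))) n) \<noteq> 0}"
  unfolding infinite_nat_iff_unbounded
proof
  fix m :: nat
  obtain n where "n \<in> {Suc m, Suc (Suc m)}" "poly (P n) 0 \<noteq> 0"
    using P_at_0_not_consecutive[of "Suc m"] by auto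
  then show "\<exists>n>m. n \<in> {n. n \<ge> 1 \<and> Determinant.det (hankel (\<lambda>i. \<Lambda> (Polynomial.monom 1 (i + 1))) n) \<noteq> 0}"
    using P_at_0_of_singular_hankel by (intro exI[of _ n]) auto
qed

end

lemma integral_scale_measure:
  fixes f :: "'a \<Rightarrow> real"
  assumes "f \<in> borel_measurable M" "r \<ge> 0"
  shows "integral\<^sup>L (scale_measure (ennreal r) M) f = r * integral\<^sup>L M f"
proof -
  have "scale_measure (ennreal r) M = density M (\<lambda>_. ennreal r)"
    by (rule measure_eqI) (auto simp: emeasure_density nn_integral_cmult_indicator)
  then show ?thesis
    using assms by (simp add: integral_density)
qed

lemma stieltjes_measure_mass_pos:
  assumes "stieltjes_measure F s \<sigma>" "F \<in> nevanlinna"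
  shows "s 0 > 0"
proof -
  have s0: "s 0 = measure \<sigma> (space \<sigma>)" and fin: "finite_measure \<sigma>"
    using assms(1) unfolding stieltjes_measure_def by (auto dest: spec[of _ 0])
  interpret finite_measure \<sigma> by fact
  show ?thesis
  proof (rule ccontr)
    assume "\<not> s 0 > 0"
    then have "measure \<sigma> (space \<sigma>) = 0"
      using s0 measure_nonneg[of \<sigma> "space \<sigma>"] by linarith
    then have "emeasure \<sigma> (space \<sigma>) = 0"
      by (simp add: emeasure_eq_measure)
    then have "AE t in \<sigma>. 1 / (complex_of_real t - \<i>) = 0"
      by (intro AE_I[of _ _ "space \<sigma>"]) auto
    then have "(LINT t|\<sigma>. 1 / (complex_of_real t - \<i>)) = 0"
      by (rule integral_eq_zero_AE)
    then have "F \<i> = 0"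
      using assms(1) unfolding stieltjes_measure_def by auto
    moreover have "F \<i> \<in> upper_half_plane"
      using assms(2) unfolding nevanlinna_def by (auto simp: image_subset_iff)
    ultimately show False by simp
  qed
qed

lemma orthogonal_recurrence_integral:
  assumes \<sigma>: "stieltjes_measure F s \<sigma>" and F: "F \<in> nevanlinna"
    and P: "monic_orthogonal_polynomials (scale_measure (ennreal (1 / s 0)) \<sigma>) P"
    and c: "\<forall>j. c j > 0"
    and rec: "\<forall>j. [:0, 1:] * P j = P (j + 1) + Polynomial.smult (b j) (P j) +
               (if j = 0 then 0 else Polynomial.smult (c (j - 1)) (P (j - 1)))"
  shows "orthogonal_recurrence (\<lambda>p. LINT t|\<sigma>. poly p t) P b c"
proof
  have sets: "sets \<sigma> = sets borel" and int: "integrable \<sigma> (\<lambda>t. t ^ j)" and s: "s j = (LINT t|\<sigma>. t ^ j)" for j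
    using \<sigma> unfolding stieltjes_measure_def by auto
  have int_poly: "integrable \<sigma> (\<lambda>t. poly p t)" for p
    unfolding poly_altdef by (intro Bochner_Integration.integrable_sum Bochner_Integration.integrable_mult_right int)
  have s0: "s 0 > 0"
    by (rule stieltjes_measure_mass_pos[OF \<sigma> F])
  show "(LINT t|\<sigma>. poly (p + r) t) = (LINT t|\<sigma>. poly p t) + (LINT t|\<sigma>. poly r t)" for p r
    using int_poly by simp
  show "(LINT t|\<sigma>. poly (Polynomial.smult a p) t) = a * (LINT t|\<sigma>. poly p t)" for a p
    by simp
  show "0 < (LINT t|\<sigma>. poly 1 t)"
    using s0 s[of 0] by simp
  show deg: "Polynomial.degree (P m) = m" "lead_coeff (P m) = 1" for m
    using P unfolding monic_orthogonal_polynomials_def by blast+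
  have "P 0 = 1"
    using deg[of 0] by (auto elim!: degree_eq_zeroE simp: one_pCons)
  show "(LINT t|\<sigma>. poly (P (Suc m)) t) = 0" for m
  proof -
    have "0 = (LINT t|scale_measure (ennreal (1 / s 0)) \<sigma>. poly (P (Suc m)) t * poly (P 0) t)"
      using P unfolding monic_orthogonal_polynomials_def by simp
    also have "\<dots> = 1 / s 0 * (LINT t|\<sigma>. poly (P (Suc m)) t)"
      using integral_scale_measure[OF borel_measurable_integrable[OF int_poly], of "1 / s 0"] s0 \<open>P 0 = 1\<close>
      by simp
    finally show ?thesis
      using s0 by simp
  qed
  show "c m > 0" for m
    using c by blast
  show "[:0, 1:] * P m = P (Suc m) + Polynomial.smult (b m) (P m) +
           (if m = 0 then 0 else Polynomial.smult (c (m - 1)) (P (m - 1)))" for m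
    using rec by simp
qed

section \<open>Block factorizations of Jacobi matrices\<close>

locale block_partition =
  fixes n :: "nat \<Rightarrow> nat"
  assumes n_0: "n 0 = 0" and n_strict_mono: "strict_mono n"
begin

abbreviation k :: "nat \<Rightarrow> nat" where
  "k \<equiv> block_size n"

lemma n_Suc: "n (Suc j) = n j + k j"
  using strict_mono_less_eq[OF n_strict_mono, of j "Suc j"] by (simp add: block_size_def)

lemma block_size_pos: "k j > 0"
  using strict_mono_less[OF n_strict_mono, of j "Suc j"] by (simp add: block_size_def)

lemma index_less: "a < k i \<Longrightarrow> i < j \<Longrightarrow> n i + a < n j"
  using strict_mono_less_eq[OF n_strict_mono, of "Suc i" j] n_Suc[of i] by linarith

lemma index_eq_iff:
  assumes "a < k i" "d < k j"
  shows "n i + a = n j + d \<longleftrightarrow> i = j \<and> a = d"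
  using index_less[OF assms(1), of j] index_less[OF assms(2), of i]
  by (cases i j rule: linorder_cases) auto

lemma index_cases: obtains i a where "m = n i + a" "a < k i"
proof -
  have "\<exists>i a. m = n i + a \<and> a < k i"
  proof (induction m)
    case 0
    then show ?case using n_0 block_size_pos[of 0] by (metis add_0)
  next
    case (Suc m)
    then obtain i a where ia: "m = n i + a" "a < k i" by blast
    show ?case
    proof (cases "Suc a < k i")
      case True
      then show ?thesis using ia by (metis add_Suc_right)
    next
      case False
      then have "Suc m = n (Suc i) + 0"
        using ia n_Suc[of i] by simp
      then show ?thesis using block_size_pos by blast
    qed
  qed
  then show ?thesis using that by blast
qed

lemma block_tridiagonal_entry:
  assumes "block_tridiagonal n A B C M" "a < k i" "d < k j"
  shows "M (n i + a) (n j + d) =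
    (if i = j then A j else if j = i + 1 then B i else if i = j + 1 then C j
     else 0\<^sub>m (k i) (k j)) $$ (a, d)"
proof -
  have "M (n i + a) (n j + d) = block n M i j $$ (a, d)"
    using assms(2,3) by (simp add: block_def)
  then show ?thesis
    using assms(1) by (simp add: block_tridiagonal_def)
qed

end

lemma inf_mat_mult_eq_sum:
  assumes "finite A" "\<And>x. x \<notin> A \<Longrightarrow> M i x = 0"
  shows "inf_mat_mult M N i j = (\<Sum>x\<in>A. M i x * N x j)"
  unfolding inf_mat_mult_def using assms by (intro Sum_any.expand_superset) auto

locale jacobi_block_LU = block_partition +
  fixes J L U :: "nat \<Rightarrow> nat \<Rightarrow> real" and b c l :: "nat \<Rightarrow> real" and u :: "nat \<Rightarrow> nat \<Rightarrow> real"
  assumes c_pos: "c m > 0"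
    and J: "J = monic_jacobi_matrix b c"
    and L: "block_tridiagonal n (\<lambda>j. 1\<^sub>m (k j)) (\<lambda>j. 0\<^sub>m (k j) (k (j + 1)))
             (\<lambda>j. upper_left (k (j + 1)) (k j) (l (j + 1))) L"
    and U: "block_tridiagonal n (\<lambda>j. companion_block (k j) (u j))
             (\<lambda>j. lower_left (k j) (k (j + 1)) 1) (\<lambda>j. 0\<^sub>m (k (j + 1)) (k j)) U"
    and LU: "J = inf_mat_mult L U"
begin

lemma L_entry:
  assumes "a < k i" "d < k j"
  shows "L (n i + a) (n j + d) =
    (if i = j \<and> a = d then 1 else if i = Suc j \<and> a = 0 \<and> d = 0 then l i else 0)"
  using assms by (subst block_tridiagonal_entry[OF L assms]) (auto simp: upper_left_def)

lemma L_eq_0: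
  assumes "a < k i" "m \<noteq> n i + a" "\<not> (\<exists>j. i = Suc j \<and> a = 0 \<and> m = n j)"
  shows "L (n i + a) m = 0"
proof -
  obtain j d where "m = n j + d" "d < k j" by (rule index_cases)
  then show ?thesis
    using assms by (auto simp: L_entry)
qed

lemma U_entry:
  assumes "a < k i" "d < k j"
  shows "U (n i + a) (n j + d) =
    (if i = j then (if a = k i - 1 then u i d else if d = a + 1 then 1 else 0)
     else if j = Suc i \<and> a = k i - 1 \<and> d = 0 then 1 else 0)"
  using assms by (subst block_tridiagonal_entry[OF U assms]) (auto simp: companion_block_def lower_left_def)

lemma J_entry_first_row:
  "J (n j) m = U (n j) m + (if j = 0 then 0 else l j * U (n (j - 1)) m)"
proof (cases j)
  case 0
  have "J (n 0) m = (\<Sum>x\<in>{n 0}. L (n 0) x * U x m)"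
    unfolding LU using L_eq_0[of 0 0] block_size_pos[of 0] by (intro inf_mat_mult_eq_sum) auto
  then show ?thesis
    using L_entry[of 0 0 0 0] block_size_pos[of 0] 0 by simp
next
  case (Suc i)
  have "n i < n j"
    using Suc strict_mono_less[OF n_strict_mono] by simp
  have "J (n j) m = (\<Sum>x\<in>{n j, n i}. L (n j) x * U x m)"
    unfolding LU using L_eq_0[of 0 j] block_size_pos[of j] Suc by (intro inf_mat_mult_eq_sum) auto
  then show ?thesis
    using L_entry[of 0 j 0 j] L_entry[of 0 j 0 i] block_size_pos[of j] block_size_pos[of i] Suc \<open>n i < n j\<close>
    by simp
qed

lemma J_entry_later_row:
  assumes "0 < a" "a < k j"
  shows "J (n j + a) m = U (n j + a) m"
proof -
  have "J (n j + a) m = (\<Sum>x\<in>{n j + a}. L (n j + a) x * U x m)"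
    unfolding LU using L_eq_0[of a j] assms by (intro inf_mat_mult_eq_sum) auto
  then show ?thesis
    using L_entry[of a j a j] assms by simp
qed

lemma block_size_cases: "k j = 1 \<or> k j = 2"
proof (rule ccontr)
  assume "\<not> ?thesis"
  then have k: "k j > 2"
    using block_size_pos[of j] by linarith
  have "J (n j + 1) (n j) = U (n j + 1) (n j + 0)"
    using J_entry_later_row[of 1 j] k by simp
  also have "\<dots> = 0"
    using k by (subst U_entry) auto
  finally have "c (n j) = 0"
    unfolding J by (simp add: monic_jacobi_matrix_def)
  then show False
    using c_pos[of "n j"] by simp
qed

lemma U_row_size_1:
  assumes "k j = 1"
  shows "U (n j) m = (if m = n j then u j 0 else if m = Suc (n j) then 1 else 0)"
proof -
  obtain i d where m: "m = n i + d" "d < k i" by (rule index_cases)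
  have "Suc (n j) = n (Suc j)"
    using n_Suc[of j] assms by simp
  then have "m = Suc (n j) \<longleftrightarrow> i = Suc j \<and> d = 0"
    using index_eq_iff[of d i 0 "Suc j"] m block_size_pos[of "Suc j"] by simp
  moreover have "m = n j \<longleftrightarrow> i = j \<and> d = 0"
    using index_eq_iff[of d i 0 j] m block_size_pos[of j] by simp
  ultimately show ?thesis
    using U_entry[of 0 j d i] m assms by auto
qed

lemma U_row_size_2:
  assumes "k j = 2"
  shows "U (n j) m = (if m = Suc (n j) then 1 else 0)"
    and "U (Suc (n j)) m = (if m = n j then u j 0 else if m = Suc (n j) then u j 1
           else if m = Suc (Suc (n j)) then 1 else 0)"
proof -
  obtain i d where m: "m = n i + d" "d < k i" by (rule index_cases)
  have "Suc (Suc (n j)) = n (Suc j)"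
    using n_Suc[of j] assms by simp
  then have 2: "m = Suc (Suc (n j)) \<longleftrightarrow> i = Suc j \<and> d = 0"
    using index_eq_iff[of d i 0 "Suc j"] m block_size_pos[of "Suc j"] by simp
  have 1: "m = Suc (n j) \<longleftrightarrow> i = j \<and> d = 1"
    using index_eq_iff[of d i 1 j] m assms by simp
  have 0: "m = n j \<longleftrightarrow> i = j \<and> d = 0"
    using index_eq_iff[of d i 0 j] m assms by simp
  show "U (n j) m = (if m = Suc (n j) then 1 else 0)"
    unfolding 1 using U_entry[of 0 j d i] m assms by auto
  show "U (Suc (n j)) m = (if m = n j then u j 0 else if m = Suc (n j) then u j 1
           else if m = Suc (Suc (n j)) then 1 else 0)"
    unfolding 0 1 2 using U_entry[of 1 j d i] m assms by (auto simp: less_2_cases_iff)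
qed

lemma u_eq_c_size_2:
  assumes "k j = 2"
  shows "u j 0 = c (n j)"
proof -
  have "J (n j + 1) (n j) = u j 0"
    using J_entry_later_row[of 1 j "n j"] assms by (simp add: U_row_size_2)
  then show ?thesis
    unfolding J by (simp add: monic_jacobi_matrix_def)
qed

lemma l_Suc: "l (Suc j) * (if k j = 1 then u j 0 else 1) = c (n (Suc j) - 1)"
proof -
  define m where "m = n (Suc j) - 1"
  have m: "n (Suc j) = Suc m" "m = n j + (k j - 1)"
    using n_Suc[of j] block_size_pos[of j] unfolding m_def by linarith+
  have "U (n (Suc j) + 0) (n j + (k j - 1)) = 0"
    using block_size_pos[of j] block_size_pos[of "Suc j"] by (subst U_entry) auto
  moreover have "J (n (Suc j)) m = c m"
    unfolding J using m(1) by (simp add: monic_jacobi_matrix_def)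
  ultimately have "c m = l (Suc j) * U (n j) m"
    using J_entry_first_row[of "Suc j" m] m(2) by simp
  moreover have "U (n j) m = (if k j = 1 then u j 0 else 1)"
    using block_size_cases[of j] m(2) by (auto simp: U_row_size_1 U_row_size_2)
  ultimately show ?thesis
    by (simp add: m_def)
qed

lemma l_Suc_neq_0: "l (Suc j) \<noteq> 0"
  using l_Suc[of j] c_pos[of "n (Suc j) - 1"] by auto

lemma u_neq_0: "u j 0 \<noteq> 0"
  using block_size_cases[of j] l_Suc[of j] u_eq_c_size_2[of j] c_pos[of "n (Suc j) - 1"] c_pos[of "n j"]
  by (auto split: if_splits)

definition gen_c :: "nat \<Rightarrow> real" where
  "gen_c j = u (Suc j) 0 * l (Suc j)"

lemma gen_c_neq_0: "gen_c j \<noteq> 0"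
  by (simp add: gen_c_def u_neq_0 l_Suc_neq_0)

definition gen_p :: "nat \<Rightarrow> real poly" where
  "gen_p j = (if k j = 1 then [:- (u j 0 + l (Suc j)), 1:] else [:- (u j 0 + l (Suc j)), - u j 1, 1:])"

lemma degree_gen_p: "Polynomial.degree (gen_p j) = k j" and monic_gen_p: "lead_coeff (gen_p j) = 1"
  using block_size_cases[of j] by (auto simp: gen_p_def)

lemma UL_row_size_1:
  assumes "k j = 1"
  shows "inf_mat_mult U L (n j + 0) m = u j 0 * L (n j + 0) m + L (n (Suc j) + 0) m"
proof -
  have "inf_mat_mult U L (n j) m = (\<Sum>x\<in>{n j, Suc (n j)}. U (n j) x * L x m)"
    by (rule inf_mat_mult_eq_sum) (auto simp: U_row_size_1[OF assms])
  then show ?thesis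
    using n_Suc[of j] assms by (simp add: U_row_size_1)
qed

lemma UL_row_size_2:
  assumes "k j = 2"
  shows "inf_mat_mult U L (n j + 0) m = L (n j + 1) m"
    and "inf_mat_mult U L (n j + 1) m = u j 0 * L (n j + 0) m + u j 1 * L (n j + 1) m + L (n (Suc j) + 0) m"
proof -
  have "inf_mat_mult U L (n j) m = (\<Sum>x\<in>{Suc (n j)}. U (n j) x * L x m)"
    by (rule inf_mat_mult_eq_sum) (auto simp: U_row_size_2[OF assms])
  then show "inf_mat_mult U L (n j + 0) m = L (n j + 1) m"
    using assms by (simp add: U_row_size_2)
  have "inf_mat_mult U L (Suc (n j)) m = (\<Sum>x\<in>{n j, Suc (n j), Suc (Suc (n j))}. U (Suc (n j)) x * L x m)"
    by (rule inf_mat_mult_eq_sum) (auto simp: U_row_size_2[OF assms])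
  then show "inf_mat_mult U L (n j + 1) m = u j 0 * L (n j + 0) m + u j 1 * L (n j + 1) m + L (n (Suc j) + 0) m"
    using n_Suc[of j] assms by (simp add: U_row_size_2)
qed

lemma UL_block_tridiagonal:
  "block_tridiagonal n
     (\<lambda>j. companion_block (k j) (\<lambda>i. - poly.coeff (gen_p j) i))
     (\<lambda>j. lower_left (k j) (k (j + 1)) 1)
     (\<lambda>j. lower_left (k (j + 1)) (k j) (gen_c j))
     (inf_mat_mult U L)"
  unfolding block_tridiagonal_def
proof (intro allI)
  fix i j
  define B where "B = (if i = j then companion_block (k j) (\<lambda>i. - poly.coeff (gen_p j) i)
     else if j = i + 1 then lower_left (k i) (k (i + 1)) 1
     else if i = j + 1 then lower_left (k (j + 1)) (k j) (gen_c j) else 0\<^sub>m (k i) (k j))"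
  have "B $$ (a, d) = inf_mat_mult U L (n i + a) (n j + d)" if "a < k i" "d < k j" for a d
  proof -
    note pos = block_size_pos[of "Suc i"] and a_less = that(1)
    consider "k i = 1" "a = 0" | "k i = 2" "a = 0" | "k i = 2" "a = 1"
      using block_size_cases[of i] a_less by atomize_elim (auto simp: less_2_cases_iff)
    then show ?thesis
    proof cases
      case 1
      have "inf_mat_mult U L (n i + a) (n j + d) =
          u i 0 * L (n i + 0) (n j + d) + L (n (Suc i) + 0) (n j + d)"
        using UL_row_size_1[OF 1(1)] 1(2) by simp
      then show ?thesis
        unfolding L_entry[OF pos that(2)] L_entry[OF that(1)[unfolded 1(2)] that(2)]
        using that 1
        by (auto simp: B_def companion_block_def lower_left_def gen_p_def gen_c_def)
    next
      case 2
      then have a1: "1 < k i" by simp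
      have "inf_mat_mult U L (n i + a) (n j + d) = L (n i + 1) (n j + d)"
        using UL_row_size_2(1)[OF 2(1)] 2(2) by simp
      then show ?thesis
        unfolding L_entry[OF a1 that(2)]
        using that 2
        by (auto simp: B_def companion_block_def lower_left_def)
    next
      case 3
      then have a1: "1 < k i" and a0: "0 < k i" by simp_all
      have "inf_mat_mult U L (n i + a) (n j + d) =
          u i 0 * L (n i + 0) (n j + d) + u i 1 * L (n i + 1) (n j + d) + L (n (Suc i) + 0) (n j + d)"
        using UL_row_size_2(2)[OF 3(1)] 3(2) by simp
      then show ?thesis
        unfolding L_entry[OF pos that(2)] L_entry[OF a1 that(2)] L_entry[OF a0 that(2)]
        using that 3
        by (auto simp: B_def companion_block_def lower_left_def gen_p_def gen_c_def less_2_cases_iff)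
    qed
  qed
  moreover have "dim_row B = k i" "dim_col B = k j"
    by (auto simp: B_def companion_block_def lower_left_def)
  ultimately have "block n (inf_mat_mult U L) i j = B"
    by (intro eq_matI) (auto simp: block_def)
  then show "block n (inf_mat_mult U L) i j = (if i = j then companion_block (k j) (\<lambda>i. - poly.coeff (gen_p j) i)
     else if j = i + 1 then lower_left (k i) (k (i + 1)) 1
     else if i = j + 1 then lower_left (k (j + 1)) (k j) (gen_c j) else 0\<^sub>m (k i) (k j))"
    unfolding B_def .
qed

definition U_first :: "(nat \<Rightarrow> complex) \<Rightarrow> nat \<Rightarrow> complex" where
  "U_first v j = (\<Sum>m\<le>Suc (n j). of_real (U (n j) m) * v m)"

lemma U_first_size_1:
  assumes "k j = 1"
  shows "U_first v j = of_real (u j 0) * v (n j) + v (Suc (n j))"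
proof -
  have "U_first v j = (\<Sum>m\<in>{n j, Suc (n j)}. of_real (U (n j) m) * v m)"
    unfolding U_first_def by (rule sum.mono_neutral_right) (auto simp: U_row_size_1[OF assms])
  then show ?thesis
    by (simp add: U_row_size_1[OF assms])
qed

lemma U_first_size_2:
  assumes "k j = 2"
  shows "U_first v j = v (Suc (n j))"
proof -
  have "U_first v j = (\<Sum>m\<in>{Suc (n j)}. of_real (U (n j) m) * v m)"
    unfolding U_first_def by (rule sum.mono_neutral_right) (auto simp: U_row_size_2[OF assms])
  then show ?thesis
    by (simp add: U_row_size_2[OF assms])
qed

lemma U_first_extend:
  assumes "n j \<le> N"
  shows "(\<Sum>m\<le>Suc N. of_real (U (n j) m) * v m) = U_first v j"
  unfolding U_first_def
proof (rule sum.mono_neutral_right)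
  show "\<forall>m\<in>{..Suc N} - {..Suc (n j)}. of_real (U (n j) m) * v m = 0"
    using block_size_cases[of j] by (auto simp: U_row_size_1 U_row_size_2)
qed (use assms in auto)

lemma J_row_sum:
  "(\<Sum>m\<le>Suc i. of_real (J i m) * v m) =
     v (Suc i) + of_real (b i) * v i + (if i = 0 then 0 else of_real (c (i - 1)) * v (i - 1))"
proof -
  have "(\<Sum>m\<le>Suc i. of_real (J i m) * v m) =
      (\<Sum>m\<in>(if i = 0 then {} else {i - 1}) \<union> {i, Suc i}. of_real (J i m) * v m)"
    by (rule sum.mono_neutral_right) (auto simp: J monic_jacobi_matrix_def)
  then show ?thesis
    by (cases i) (auto simp: J monic_jacobi_matrix_def)
qed

context
  fixes v :: "nat \<Rightarrow> complex" and z s0 :: complex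
  assumes v: "\<And>i. z * v i + (if i = 0 then s0 else 0) =
    v (Suc i) + of_real (b i) * v i + (if i = 0 then 0 else of_real (c (i - 1)) * v (i - 1))"
begin

lemma U_first_solution:
  "U_first v j + (if j = 0 then 0 else of_real (l j) * U_first v (j - 1)) = z * v (n j) + (if j = 0 then s0 else 0)"
proof -
  have "n j = 0 \<longleftrightarrow> j = 0"
    using n_0 strict_mono_eq[OF n_strict_mono, of j 0] by simp
  then have "z * v (n j) + (if j = 0 then s0 else 0) = (\<Sum>m\<le>Suc (n j). of_real (J (n j) m) * v m)"
    unfolding J_row_sum using v[of "n j"] by simp
  also have "\<dots> = U_first v j +
      (if j = 0 then 0 else of_real (l j) * (\<Sum>m\<le>Suc (n j). of_real (U (n (j - 1)) m) * v m))"
    by (simp add: J_entry_first_row distrib_right sum.distrib sum_distrib_left U_first_def mult.assoc distrib_left)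
  also have "(\<Sum>m\<le>Suc (n j). of_real (U (n (j - 1)) m) * v m) = U_first v (j - 1)"
    by (intro U_first_extend) (simp add: strict_mono_less_eq[OF n_strict_mono])
  finally show ?thesis by simp
qed

lemma later_row_solution:
  assumes "k j = 2"
  shows "z * v (Suc (n j)) = of_real (u j 0) * v (n j) + of_real (u j 1) * v (Suc (n j)) + v (Suc (Suc (n j)))"
proof -
  have J: "J (Suc (n j)) m = U (Suc (n j)) m" for m
    using J_entry_later_row[of 1 j m] assms by simp
  have "z * v (Suc (n j)) = (\<Sum>m\<le>Suc (Suc (n j)). of_real (J (Suc (n j)) m) * v m)"
    unfolding J_row_sum using v[of "Suc (n j)"] by simp
  also have "\<dots> = (\<Sum>m\<in>{n j, Suc (n j), Suc (Suc (n j))}. of_real (J (Suc (n j)) m) * v m)"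
    by (rule sum.mono_neutral_right) (auto simp: J U_row_size_2[OF assms])
  finally show ?thesis
    by (simp add: J U_row_size_2[OF assms])
qed

lemma U_first_recurrence:
  "poly (map_poly of_real (gen_p j)) z * U_first v j =
     U_first v (Suc j) + (if j = 0 then - (of_real (u 0 0) * s0) else of_real (gen_c (j - 1)) * U_first v (j - 1))"
proof -
  define r where "r = U_first v j"
  define e where "e = (if j = 0 then - s0 else of_real (l j) * U_first v (j - 1))"
  have 1: "z * v (n j) = r + e"
    using U_first_solution[of j] by (auto simp: r_def e_def algebra_simps)
  have 2: "z * v (n (Suc j)) = U_first v (Suc j) + of_real (l (Suc j)) * r"
    using U_first_solution[of "Suc j"] by (simp add: r_def)
  have "poly (map_poly of_real (gen_p j)) z * r = U_first v (Suc j) + of_real (u j 0) * e"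
  proof (cases "k j = 1")
    case True
    then have "r = of_real (u j 0) * v (n j) + v (n (Suc j))"
      using U_first_size_1[of j v] n_Suc[of j] by (simp add: r_def)
    then have "z * r = of_real (u j 0) * (r + e) + (U_first v (Suc j) + of_real (l (Suc j)) * r)"
      unfolding 1[symmetric] 2[symmetric] by (simp add: algebra_simps)
    then show ?thesis
      using True by (simp add: gen_p_def map_poly_pCons algebra_simps)
  next
    case False
    then have k: "k j = 2"
      using block_size_cases[of j] by simp
    have "r = v (Suc (n j))"
      using U_first_size_2[OF k] by (simp add: r_def)
    then have "z * r = of_real (u j 0) * v (n j) + of_real (u j 1) * r + v (n (Suc j))"
      using later_row_solution[OF k] n_Suc[of j] k by simp
    then have "z * (z * r) = z * (of_real (u j 0) * v (n j) + of_real (u j 1) * r + v (n (Suc j)))"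
      by (rule arg_cong)
    then have "z * (z * r) = of_real (u j 0) * (r + e) + z * (of_real (u j 1) * r) +
        (U_first v (Suc j) + of_real (l (Suc j)) * r)"
      unfolding 1[symmetric] 2[symmetric] by (simp add: algebra_simps)
    then show ?thesis
      using False by (simp add: gen_p_def map_poly_pCons algebra_simps)
  qed
  then show ?thesis
    by (cases j) (auto simp: r_def e_def gen_c_def)
qed

end

end

section \<open>The continued fraction\<close>

lemma eventually_upper_half_plane: "eventually (\<lambda>z. z \<in> upper_half_plane) sector_infinity"
proof -
  have "eventually (\<lambda>z. z \<in> upper_half_plane) (inf at_infinity (principal {z. \<epsilon> < Arg z \<and> Arg z < pi - \<epsilon>}))"
    if "\<epsilon> > 0" for \<epsilon> :: real
  proof -
    have "Im z > 0" if "\<epsilon> < Arg z" "Arg z < pi - \<epsilon>" for z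
      using that \<open>\<epsilon> > 0\<close> Arg_lt_pi[of z] by auto
    then show ?thesis
      unfolding eventually_inf_principal by (auto intro: always_eventually)
  qed
  then show ?thesis
    unfolding sector_infinity_def eventually_Sup by blast
qed

lemma holomorphic_nonzero_cosparse:
  assumes "f holomorphic_on upper_half_plane" "eventually (\<lambda>z. f z \<noteq> 0) sector_infinity"
  shows "\<forall>\<^sub>\<approx>z\<in>upper_half_plane. f z \<noteq> 0"
proof -
  have "eventually (\<lambda>z. f z \<noteq> 0 \<and> z \<in> upper_half_plane) sector_infinity"
    using assms(2) eventually_upper_half_plane by (rule eventually_conj)
  then obtain \<beta> where \<beta>: "\<beta> \<in> upper_half_plane" "f \<beta> \<noteq> 0"
    using sector_infinity_neq_bot eventually_happens by blast
  have "open upper_half_plane"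
    by (rule open_halfspace_Im_gt)
  moreover have "connected upper_half_plane"
    by (rule convex_connected[OF convex_halfspace_Im_gt])
  ultimately have "eventually (\<lambda>w. f w \<noteq> 0 \<and> w \<in> upper_half_plane) (at z)" if "z \<in> upper_half_plane" for z
    using non_zero_neighbour_alt[OF assms(1) _ _ that \<beta>] by blast
  then show ?thesis
    unfolding eventually_cosparse_open_eq[OF \<open>open upper_half_plane\<close>] by (blast intro: eventually_mono)
qed

lemma fps_eq_X_power_mult_shift:
  fixes a :: "'a::comm_ring_1 fps"
  assumes "\<And>i. i < N \<Longrightarrow> fps_nth a i = 0"
  shows "a = fps_X ^ N * fps_shift N a"
  by (rule fps_ext) (use assms in \<open>auto simp: fps_X_power_mult_nth\<close>)

lemma asymptotic_series_divide:
  assumes "asymptotic_series f s"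
  shows "asymptotic_series (\<lambda>z. f z / of_real a) (\<lambda>j. s j / a)"
proof -
  have eq: "fps_const (1 / a) * (- (fps_X * Abs_fps s)) = - (fps_X * Abs_fps (\<lambda>j. s j / a))"
    by (rule fps_ext) simp
  show ?thesis
    using expands_cmult[OF assms[unfolded asymptotic_series_iff_expands], of "1 / a"]
    unfolding asymptotic_series_iff_expands eq by simp
qed

lemma asymptotic_series_mult_z:
  assumes "asymptotic_series f s"
  shows "asymptotic_series (\<lambda>z. z * f z + of_real (s 0)) (\<lambda>j. s (j + 1))"
proof -
  have "expands (\<lambda>z. z * f z) (- Abs_fps s)"
    using assms unfolding asymptotic_series_iff_expands by (intro expands_mult_z) simp
  then have "expands (\<lambda>z. z * f z + of_real (s 0)) (- Abs_fps s + fps_const (s 0))"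
    by (rule expands_add[OF _ expands_const])
  moreover have "- Abs_fps s + fps_const (s 0) = - (fps_X * Abs_fps (\<lambda>j. s (j + 1)))"
    by (rule fps_ext) auto
  ultimately show ?thesis
    unfolding asymptotic_series_iff_expands by simp
qed

lemma first_coeff_divide: "a \<noteq> 0 \<Longrightarrow> first_coeff (\<lambda>j. s j / a) = first_coeff s / a"
  unfolding first_coeff_def by simp

lemma normal_index_divide:
  assumes "a \<noteq> 0"
  shows "normal_index (\<lambda>j. s j / a) = normal_index s"
proof -
  have "hankel (\<lambda>j. s j / a) n = (1 / a) \<cdot>\<^sub>m hankel s n" for n
    by (rule eq_matI) (auto simp: hankel_def)
  then have "Determinant.det (hankel (\<lambda>j. s j / a) n) = 0 \<longleftrightarrow> Determinant.det (hankel s n) = 0" for n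
    using assms by simp
  then show ?thesis
    by (simp add: normal_index_def fun_eq_iff)
qed

lemma normal_index_strict_mono:
  assumes "infinite {n. n \<ge> 1 \<and> Determinant.det (hankel s n) \<noteq> 0}"
  shows "strict_mono (normal_index s)"
proof (rule strict_monoI_Suc)
  fix j
  show "normal_index s j < normal_index s (Suc j)"
  proof (cases j)
    case 0
    then show ?thesis
      using enumerate_in_set[OF assms, of 0] by (auto simp: normal_index_def)
  next
    case (Suc i)
    then show ?thesis
      using enumerate_step[OF assms, of i] by (simp add: normal_index_def)
  qed
qed

lemma rational_function_of_mult_z:
  assumes "rational_function (\<lambda>z. z * F z + a)"
  shows "rational_function F"
proof -
  obtain p q where q: "q \<noteq> 0" and eq: "\<forall>\<^sub>\<approx>z\<in>upper_half_plane. z * F z + a = poly p z / poly q z"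
    using assms unfolding rational_function_def by blast
  have "\<forall>\<^sub>\<approx>z\<in>upper_half_plane. poly q z \<noteq> 0"
    using poly_roots_finite[OF q]
    by (simp add: eventually_cosparse finite_imp_sparse)
  moreover have "\<forall>\<^sub>\<approx>z\<in>upper_half_plane. z \<in> upper_half_plane"
    by (rule eventually_in_cosparse) (auto intro: open_halfspace_Im_gt)
  ultimately have "\<forall>\<^sub>\<approx>z\<in>upper_half_plane. F z = poly (p - Polynomial.smult a q) z / poly (pCons 0 q) z"
    using eq
  proof eventually_elim
    case (elim z)
    then have "z \<noteq> 0" by auto
    moreover have "z * F z = (poly p z - a * poly q z) / poly q z"
      using elim by (simp add: field_simps)
    ultimately have "F z = (poly p z - a * poly q z) / poly q z / z"
      by (metis nonzero_mult_div_cancel_left)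
    then show ?case
      by (simp add: mult.commute)
  qed
  then show ?thesis
    unfolding rational_function_def using q by (metis pCons_eq_0_iff)
qed

lemma D_minus_of_nevanlinna:
  assumes "F \<in> nevanlinna_inf" "a \<noteq> 0"
  shows "(\<lambda>z. z * F z + of_real a) \<in> D_minus"
proof -
  have F: "F holomorphic_on upper_half_plane"
    using assms(1) by (simp add: nevanlinna_inf_def nevanlinna_def)
  have eq: "- of_real a / z + (z * F z + of_real a) / z = F z" if "z \<noteq> 0" for z
    using that by (simp add: field_simps)
  have "(\<lambda>z. - of_real a / z + (z * F z + of_real a) / z) holomorphic_on upper_half_plane"
    by (rule holomorphic_transform[OF F], subst eq) auto
  moreover have "(\<lambda>z. - of_real a / z + (z * F z + of_real a) / z) ` upper_half_plane \<subseteq> upper_half_plane"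
  proof clarify
    fix z :: complex assume z: "0 < Im z"
    then have "z \<noteq> 0" by auto
    moreover have "0 < Im (F z)"
      using assms(1) z by (auto simp: nevanlinna_inf_def nevanlinna_def image_subset_iff)
    ultimately show "0 < Im (- of_real a / z + (z * F z + of_real a) / z)"
      by (simp only: eq not_False_eq_True)
  qed
  moreover
  have "eventually (\<lambda>z. F z = - of_real a / z + (z * F z + of_real a) / z) sector_infinity"
    using eventually_neq_0 by eventually_elim (rule eq[symmetric])
  then have "expands F t = expands (\<lambda>z. - of_real a / z + (z * F z + of_real a) / z) t" for t
    by (rule expands_cong)
  then have "\<exists>s. asymptotic_series (\<lambda>z. - of_real a / z + (z * F z + of_real a) / z) s"
    using assms(1) unfolding nevanlinna_inf_def asymptotic_series_iff_expands by simp
  moreover have "(\<lambda>z. z * F z + of_real a) meromorphic_on upper_half_plane"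
    using F open_halfspace_Im_gt
    by (intro analytic_on_imp_meromorphic_on) (simp add: analytic_on_open holomorphic_intros)
  ultimately show ?thesis
    unfolding D_minus_def nevanlinna_inf_def nevanlinna_def using assms(2) by blast
qed

locale orthogonal_block_LU = orthogonal_recurrence \<Lambda> P b c + jacobi_block_LU n J L U b c l u
  for \<Lambda> P b c n J L U l u +
  fixes F :: "complex \<Rightarrow> complex"
  assumes F_holomorphic: "F holomorphic_on upper_half_plane"
    and F_series: "asymptotic_series F (mixed_moment 0)"
begin

text \<open>These are the functions of the second kind \<open>\<integral> P m t / (t - z) d\<sigma>(t)\<close>; only their recurrence
  and their expansion at infinity matter.\<close>

fun second_kind :: "nat \<Rightarrow> complex \<Rightarrow> complex" where
  "second_kind 0 z = F z"
| "second_kind (Suc 0) z = (z * F z - of_real (b 0) * F z) + of_real (mixed_moment 0 0)"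
| "second_kind (Suc (Suc m)) z =
     (z * second_kind (Suc m) z - of_real (b (Suc m)) * second_kind (Suc m) z) - of_real (c m) * second_kind m z"

lemma second_kind_holomorphic: "second_kind m holomorphic_on upper_half_plane"
proof -
  have "(\<lambda>z. second_kind m z) holomorphic_on upper_half_plane"
    by (induction m rule: induct_nat_012) (auto intro!: holomorphic_intros F_holomorphic)
  then show ?thesis .
qed

lemma second_kind_recurrence:
  "z * second_kind i z + (if i = 0 then of_real (mixed_moment 0 0) else 0) =
     second_kind (Suc i) z + of_real (b i) * second_kind i z +
     (if i = 0 then 0 else of_real (c (i - 1)) * second_kind (i - 1) z)"
  by (cases i) auto

lemma second_kind_expands: "expands (second_kind m) (- (fps_X * Abs_fps (mixed_moment m)))"
proof -
  have step: "expands (\<lambda>z. z * second_kind m z - of_real (b m) * second_kind m z)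
      (- Abs_fps (mixed_moment m) - fps_const (b m) * - (fps_X * Abs_fps (mixed_moment m)))"
    if "expands (second_kind m) (- (fps_X * Abs_fps (mixed_moment m)))" for m
    using that by (intro expands_diff expands_cmult expands_mult_z) simp_all
  have "expands (\<lambda>z. second_kind m z) (- (fps_X * Abs_fps (mixed_moment m)))"
  proof (induction m rule: induct_nat_012)
    case 0
    show ?case
      using F_series unfolding asymptotic_series_iff_expands by simp
  next
    case 1
    have "second_kind 0 = F"
      by (rule ext) simp
    then have "expands (second_kind 0) (- (fps_X * Abs_fps (mixed_moment 0)))"
      using F_series unfolding asymptotic_series_iff_expands by simp
    from expands_add[OF step[OF this] expands_const[of "mixed_moment 0 0"]]
    have "expands (\<lambda>z. second_kind (Suc 0) z) (- Abs_fps (mixed_moment 0) -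
        fps_const (b 0) * - (fps_X * Abs_fps (mixed_moment 0)) + fps_const (mixed_moment 0 0))"
      by simp
    also have "- Abs_fps (mixed_moment 0) -
        fps_const (b 0) * - (fps_X * Abs_fps (mixed_moment 0)) + fps_const (mixed_moment 0 0) =
        - (fps_X * Abs_fps (mixed_moment (Suc 0)))"
    proof (rule fps_ext)
      fix i
      show "fps_nth (- Abs_fps (mixed_moment 0) -
        fps_const (b 0) * - (fps_X * Abs_fps (mixed_moment 0)) + fps_const (mixed_moment 0 0)) i =
        fps_nth (- (fps_X * Abs_fps (mixed_moment (Suc 0)))) i"
        by (cases i) (auto simp: mixed_moment_Suc[of 0])
    qed
    finally show ?case .
  next
    case (ge2 m)
    from expands_diff[OF step[OF ge2(2)] expands_cmult[OF ge2(1), of "c m"]]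
    have "expands (\<lambda>z. second_kind (Suc (Suc m)) z) (- Abs_fps (mixed_moment (Suc m)) -
        fps_const (b (Suc m)) * - (fps_X * Abs_fps (mixed_moment (Suc m))) -
        fps_const (c m) * - (fps_X * Abs_fps (mixed_moment m)))"
      by simp
    also have "- Abs_fps (mixed_moment (Suc m)) -
        fps_const (b (Suc m)) * - (fps_X * Abs_fps (mixed_moment (Suc m))) -
        fps_const (c m) * - (fps_X * Abs_fps (mixed_moment m)) =
        - (fps_X * Abs_fps (mixed_moment (Suc (Suc m))))"
    proof (rule fps_ext)
      fix i
      show "fps_nth (- Abs_fps (mixed_moment (Suc m)) -
        fps_const (b (Suc m)) * - (fps_X * Abs_fps (mixed_moment (Suc m))) -
        fps_const (c m) * - (fps_X * Abs_fps (mixed_moment m))) i =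
        fps_nth (- (fps_X * Abs_fps (mixed_moment (Suc (Suc m))))) i"
        by (cases i) (auto simp: mixed_moment_Suc[of "Suc m"] mixed_moment_0)
    qed
    finally show ?case .
  qed
  then show ?thesis .
qed

definition sol :: "nat \<Rightarrow> complex \<Rightarrow> complex" where
  "sol j z = U_first (\<lambda>m. second_kind m z) j"

definition \<rho> :: "nat \<Rightarrow> real" where
  "\<rho> j = u j 0 * mixed_moment (n j) (n j)"

lemma \<rho>_neq_0: "\<rho> j \<noteq> 0"
  using mixed_moment_diag_pos[of "n j"] u_neq_0[of j] by (simp add: \<rho>_def)

lemma \<rho>_Suc: "\<rho> (Suc j) = gen_c j * \<rho> j"
proof (cases "k j = 1")
  case True
  then show ?thesis
    using l_Suc[of j] n_Suc[of j] by (simp add: \<rho>_def gen_c_def mixed_moment_diag_Suc)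
next
  case False
  then have "k j = 2"
    using block_size_cases[of j] by simp
  then show ?thesis
    using l_Suc[of j] n_Suc[of j] u_eq_c_size_2[of j]
    by (simp add: \<rho>_def gen_c_def mixed_moment_diag_Suc)
qed

lemma sol_holomorphic: "sol j holomorphic_on upper_half_plane"
  unfolding sol_def[abs_def] U_first_def
  by (intro holomorphic_intros second_kind_holomorphic)

lemma sol_expands: "\<exists>a. expands (sol j) (fps_X ^ n (Suc j) * a) \<and> fps_nth a 0 = - \<rho> j"
proof -
  obtain a where a: "expands (sol j) a" "\<And>i. i < n (Suc j) \<Longrightarrow> fps_nth a i = 0"
    "fps_nth a (n (Suc j)) = - \<rho> j"
  proof (cases "k j = 1")
    case True
    define a where "a = fps_const (u j 0) * (- (fps_X * Abs_fps (mixed_moment (n j)))) +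
       (- (fps_X * Abs_fps (mixed_moment (Suc (n j)))))"
    have "expands (sol j) a"
      unfolding sol_def[abs_def] U_first_size_1[OF True] a_def
      by (intro expands_add expands_cmult second_kind_expands)
    moreover have "fps_nth a i = 0" if "i < n (Suc j)" for i
      using that True n_Suc[of j] by (auto simp: a_def mixed_moment_below)
    moreover have "fps_nth a (n (Suc j)) = - \<rho> j"
      using True n_Suc[of j] by (auto simp: a_def mixed_moment_below \<rho>_def)
    ultimately show ?thesis by (rule that)
  next
    case False
    then have k: "k j = 2"
      using block_size_cases[of j] by simp
    define a where "a = - (fps_X * Abs_fps (mixed_moment (Suc (n j))))"
    have "expands (sol j) a"
      unfolding sol_def[abs_def] U_first_size_2[OF k] a_def by (rule second_kind_expands)
    moreover have "fps_nth a i = 0" if "i < n (Suc j)" for i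
      using that k n_Suc[of j] by (auto simp: a_def mixed_moment_below)
    moreover have "fps_nth a (n (Suc j)) = - \<rho> j"
      using k n_Suc[of j] by (auto simp: a_def mixed_moment_diag_Suc u_eq_c_size_2 \<rho>_def)
    ultimately show ?thesis by (rule that)
  qed
  then show ?thesis
    using fps_eq_X_power_mult_shift[of "n (Suc j)" a] by (intro exI[of _ "fps_shift (n (Suc j)) a"]) auto
qed

text \<open>The value at \<open>j = 0\<close> makes the three-term recurrence of \<open>sol\<close> hold uniformly in \<open>j\<close>.\<close>

definition prev_sol :: "nat \<Rightarrow> complex \<Rightarrow> complex" where
  "prev_sol j z = (if j = 0 then - of_real (\<rho> 0) else of_real (gen_c (j - 1)) * sol (j - 1) z)"

lemma prev_sol_expands: "\<exists>a. expands (prev_sol j) (fps_X ^ n j * a) \<and> fps_nth a 0 = - \<rho> j"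
proof (cases j)
  case 0
  then show ?thesis
    using expands_const[of "- \<rho> 0"] n_0
    by (intro exI[of _ "fps_const (- \<rho> 0)"]) (simp add: prev_sol_def[abs_def])
next
  case (Suc i)
  obtain a where "expands (sol i) (fps_X ^ n (Suc i) * a)" "fps_nth a 0 = - \<rho> i"
    using sol_expands by blast
  then show ?thesis
    using expands_cmult[of "sol i" "fps_X ^ n (Suc i) * a" "gen_c i"] Suc
    by (intro exI[of _ "fps_const (gen_c i) * a"]) (simp add: prev_sol_def[abs_def] \<rho>_Suc mult.left_commute)
qed

lemma prev_sol_holomorphic: "prev_sol j holomorphic_on upper_half_plane"
  unfolding prev_sol_def[abs_def] using sol_holomorphic by (cases j) (auto intro!: holomorphic_intros)

lemma sol_recurrence: "poly (map_poly of_real (gen_p j)) z * sol j z = sol (Suc j) z + prev_sol j z"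
  using U_first_recurrence[where v = "\<lambda>m. second_kind m z" and z = z, OF second_kind_recurrence, of j]
  by (simp add: sol_def prev_sol_def \<rho>_def n_0)

lemma sol_0: "sol 0 z = z * F z + of_real (mixed_moment 0 0)"
  using U_first_solution[where v = "\<lambda>m. second_kind m z" and z = z, OF second_kind_recurrence, of 0]
  by (simp add: sol_def n_0)

lemma sol_eventually_neq_0: "eventually (\<lambda>z. sol j z \<noteq> 0) sector_infinity"
proof -
  obtain a where "expands (sol j) (fps_X ^ n (Suc j) * a)" "fps_nth a 0 = - \<rho> j"
    using sol_expands by blast
  then have "eventually (\<lambda>z. z ^ n (Suc j) * sol j z \<noteq> 0) sector_infinity"
    using \<rho>_neq_0 by (intro expands_eventually_neq_0[OF expands_mult_z_power]) auto
  then show ?thesis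
    by eventually_elim auto
qed

definition transform :: "nat \<Rightarrow> complex \<Rightarrow> complex" where
  "transform j z = - of_real (sgn (\<rho> j)) * sol j z / prev_sol j z"

lemma transform_meromorphic: "transform j meromorphic_on upper_half_plane"
proof -
  have "sol j meromorphic_on upper_half_plane" "prev_sol j meromorphic_on upper_half_plane"
    using sol_holomorphic[of j] prev_sol_holomorphic[of j] open_halfspace_Im_gt
    by (auto intro!: analytic_on_imp_meromorphic_on simp: analytic_on_open)
  then have "(\<lambda>z. (\<lambda>_. - of_real (sgn (\<rho> j))) z * sol j z / prev_sol j z) meromorphic_on upper_half_plane"
    by (intro meromorphic_intros)
  then show ?thesis
    by (simp add: transform_def[abs_def])
qed

lemma transform_series: "\<exists>S. asymptotic_series (transform j) S \<and> first_coeff S = sgn (\<rho> j)"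
proof -
  obtain A B where A: "expands (sol j) (fps_X ^ n (Suc j) * A)" "fps_nth A 0 = - \<rho> j"
    and B: "expands (prev_sol j) (fps_X ^ n j * B)" "fps_nth B 0 = - \<rho> j"
    using sol_expands prev_sol_expands by blast
  define D where "D = fps_const (- sgn (\<rho> j)) * (A * inverse B)"
  have num: "expands (\<lambda>z. z ^ n j * sol j z) (fps_X ^ k j * A)"
    using A(1) by (intro expands_mult_z_power) (simp add: n_Suc power_add mult.assoc)
  have "expands (\<lambda>z. 1 / (z ^ n j * prev_sol j z)) (inverse B)"
    using B \<rho>_neq_0 by (intro expands_inverse expands_mult_z_power) auto
  then have "expands (\<lambda>z. of_real (- sgn (\<rho> j)) * (z ^ n j * sol j z * (1 / (z ^ n j * prev_sol j z))))
      (fps_const (- sgn (\<rho> j)) * (fps_X ^ k j * A * inverse B))"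
    by (intro expands_cmult expands_mult[OF num])
  moreover have "eventually (\<lambda>z. of_real (- sgn (\<rho> j)) * (z ^ n j * sol j z * (1 / (z ^ n j * prev_sol j z))) = transform j z)
      sector_infinity"
    using eventually_neq_0 by eventually_elim (simp add: transform_def)
  ultimately have expansion: "expands (transform j) (fps_X ^ k j * D)"
    using expands_cong by (simp add: D_def mult_ac)
  define S where "S i = (if Suc i < k j then 0 else - fps_nth D (Suc i - k j))" for i
  have "fps_X ^ k j * D = - (fps_X * Abs_fps S)"
  proof (rule fps_ext)
    fix i
    show "fps_nth (fps_X ^ k j * D) i = fps_nth (- (fps_X * Abs_fps S)) i"
      using block_size_pos[of j] by (cases i) (auto simp: fps_X_power_mult_nth S_def)
  qed
  then have "asymptotic_series (transform j) S"
    using expansion by (simp add: asymptotic_series_iff_expands)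
  moreover have "S (k j - 1) = sgn (\<rho> j)"
    using block_size_pos[of j] A(2) B(2) \<rho>_neq_0[of j] by (simp add: S_def D_def)
  moreover have "(LEAST i. S i \<noteq> 0) = k j - 1"
  proof (rule Least_equality)
    show "S (k j - 1) \<noteq> 0"
      using \<open>S (k j - 1) = sgn (\<rho> j)\<close> \<rho>_neq_0[of j] by (simp add: sgn_0_0)
    show "k j - 1 \<le> i" if "S i \<noteq> 0" for i
      using that by (auto simp: S_def split: if_splits)
  qed
  ultimately show ?thesis
    unfolding first_coeff_def by auto
qed

lemma transform_recurrence:
  assumes "sol j z \<noteq> 0"
  shows "- 1 / transform j z = of_real (sgn (\<rho> j)) * poly (map_poly of_real (gen_p j)) z
     + of_real ((sqrt \<bar>gen_c j\<bar>)\<^sup>2) * transform (Suc j) z"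
proof -
  define p where "p = poly (map_poly of_real (gen_p j)) z"
  define \<epsilon> where "\<epsilon> = complex_of_real (sgn (\<rho> j))"
  have \<epsilon>: "\<epsilon> * \<epsilon> = 1" "\<epsilon> \<noteq> 0"
    using \<rho>_neq_0[of j] by (auto simp: \<epsilon>_def sgn_if)
  have "- 1 / transform j z = \<epsilon> * prev_sol j z / sol j z"
    using \<epsilon> assms by (cases "prev_sol j z = 0") (simp_all add: transform_def \<epsilon>_def[symmetric] field_simps)
  also have "prev_sol j z = p * sol j z - sol (Suc j) z"
    using sol_recurrence[of j z] by (simp add: p_def)
  also have "\<epsilon> * (p * sol j z - sol (Suc j) z) / sol j z = \<epsilon> * p - \<epsilon> * sol (Suc j) z / sol j z"
    using assms by (simp add: field_simps)
  also have "sgn (\<rho> (Suc j)) * \<bar>gen_c j\<bar> = sgn (\<rho> j) * gen_c j"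
    by (auto simp: \<rho>_Suc sgn_mult abs_sgn mult_ac)
  then have "complex_of_real (sgn (\<rho> (Suc j)) * \<bar>gen_c j\<bar>) = \<epsilon> * of_real (gen_c j)"
    by (simp add: \<epsilon>_def)
  then have "- (\<epsilon> * sol (Suc j) z / sol j z) = of_real \<bar>gen_c j\<bar> * transform (Suc j) z"
    using assms gen_c_neq_0[of j] by (simp add: transform_def prev_sol_def field_simps)
  then have "\<epsilon> * p - \<epsilon> * sol (Suc j) z / sol j z = \<epsilon> * p + of_real \<bar>gen_c j\<bar> * transform (Suc j) z"
    by (metis uminus_add_conv_diff add.commute)
  finally show ?thesis
    by (simp add: \<epsilon>_def p_def)
qed

lemma transform_tendsto_0: "(transform j \<longlongrightarrow> 0) sector_infinity"
proof -
  obtain S where "expands (transform j) (- (fps_X * Abs_fps S))"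
    using transform_series unfolding asymptotic_series_iff_expands by blast
  from expands_tendsto[OF this] show ?thesis by simp
qed

lemma transform_0: "transform 0 z = (z * F z + of_real (mixed_moment 0 0)) / of_real \<bar>\<rho> 0\<bar>"
proof -
  have "complex_of_real (sgn (\<rho> 0)) / of_real (\<rho> 0) = 1 / of_real \<bar>\<rho> 0\<bar>"
    using \<rho>_neq_0[of 0] by (auto simp: sgn_if)
  then show ?thesis
    using \<rho>_neq_0[of 0] by (simp add: transform_def prev_sol_def sol_0 field_simps)
qed

lemma first_coeff_moments: "first_coeff (\<lambda>j. mixed_moment 0 (j + 1)) = \<rho> 0"
proof -
  have "asymptotic_series (transform 0) (\<lambda>j. mixed_moment 0 (j + 1) / \<bar>\<rho> 0\<bar>)"
    unfolding transform_0[abs_def] by (intro asymptotic_series_divide asymptotic_series_mult_z F_series)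
  then have "first_coeff (\<lambda>j. mixed_moment 0 (j + 1) / \<bar>\<rho> 0\<bar>) = sgn (\<rho> 0)"
    using transform_series asymptotic_series_unique by blast
  then show ?thesis
    using \<rho>_neq_0[of 0] by (auto simp: first_coeff_divide field_simps sgn_if split: if_splits)
qed

lemma normalized_gen_jacobi_matrix_UL:
  assumes "n = normal_index (\<lambda>j. mixed_moment 0 (j + 1))"
  shows "normalized_gen_jacobi_matrix_of (transform 0) (inf_mat_mult U L)"
proof -
  obtain S where S: "\<And>j. asymptotic_series (transform j) (S j)" "\<And>j. first_coeff (S j) = sgn (\<rho> j)"
    using transform_series by metis
  have "asymptotic_series (transform 0) (\<lambda>j. mixed_moment 0 (j + 1) / \<bar>\<rho> 0\<bar>)"
    unfolding transform_0[abs_def] by (intro asymptotic_series_divide asymptotic_series_mult_z F_series)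
  then have "S 0 = (\<lambda>j. mixed_moment 0 (j + 1) / \<bar>\<rho> 0\<bar>)"
    using S(1) asymptotic_series_unique by blast
  then have n: "normal_index (S 0) = n"
    using \<rho>_neq_0[of 0] by (simp add: assms normal_index_divide)
  have c: "sgn (\<rho> j) * sgn (\<rho> (j + 1)) * (sqrt \<bar>gen_c j\<bar>)\<^sup>2 = gen_c j" for j
  proof -
    have "sgn (\<rho> j) * sgn (\<rho> j) = 1"
      using \<rho>_neq_0[of j] by (simp add: sgn_if)
    then have "sgn (\<rho> j) * (sgn (gen_c j) * sgn (\<rho> j)) * \<bar>gen_c j\<bar> = sgn (gen_c j) * \<bar>gen_c j\<bar>"
      by (metis mult.left_commute mult.right_neutral)
    then show ?thesis
      by (simp add: \<rho>_Suc sgn_mult sgn_mult_abs)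
  qed
  have rec: "\<forall>\<^sub>\<approx>z\<in>upper_half_plane. - 1 / transform j z = of_real (sgn (\<rho> j)) * poly (map_poly of_real (gen_p j)) z
       + of_real ((sqrt \<bar>gen_c j\<bar>)\<^sup>2) * transform (j + 1) z" for j
    using holomorphic_nonzero_cosparse[OF sol_holomorphic sol_eventually_neq_0, of j]
    by eventually_elim (use transform_recurrence in simp)
  have lim: "((\<lambda>z. - 1 / transform j z - of_real (sgn (\<rho> j)) * poly (map_poly of_real (gen_p j)) z) \<longlongrightarrow> 0)
      sector_infinity" for j
  proof -
    have "((\<lambda>z. of_real ((sqrt \<bar>gen_c j\<bar>)\<^sup>2) * transform (Suc j) z) \<longlongrightarrow> of_real ((sqrt \<bar>gen_c j\<bar>)\<^sup>2) * 0) sector_infinity"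
      by (intro tendsto_intros transform_tendsto_0)
    moreover have "eventually (\<lambda>z. of_real ((sqrt \<bar>gen_c j\<bar>)\<^sup>2) * transform (Suc j) z =
        - 1 / transform j z - of_real (sgn (\<rho> j)) * poly (map_poly of_real (gen_p j)) z) sector_infinity"
      using sol_eventually_neq_0[of j]
    proof eventually_elim
      case (elim z)
      show ?case
        unfolding transform_recurrence[OF elim] by (rule add_diff_cancel_left'[symmetric])
    qed
    ultimately show ?thesis
      by (simp add: tendsto_cong)
  qed
  have abs: "\<bar>sgn (\<rho> j)\<bar> = 1" for j
    using \<rho>_neq_0[of j] by (simp add: sgn_if)
  show ?thesis
    unfolding normalized_gen_jacobi_matrix_of_def Let_def
    by (rule exI[of _ transform], rule exI[of _ S], rule exI[of _ "\<lambda>j. sgn (\<rho> j)"], rule exI[of _ gen_p],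
        rule exI[of _ "\<lambda>j. sqrt \<bar>gen_c j\<bar>"])
       (use S transform_meromorphic abs degree_gen_p monic_gen_p lim gen_c_neq_0 rec UL_block_tridiagonal in
         \<open>simp only: n c, auto\<close>)
qed

end

theorem theorem3p2:
  fixes F :: "complex \<Rightarrow> complex" and s :: "nat \<Rightarrow> real"
    and J L U :: "nat \<Rightarrow> nat \<Rightarrow> real"
  assumes "F \<in> nevanlinna_inf"
    and "\<not> rational_function F"
    and "asymptotic_series F s"
    and "monic_jacobi_matrix_of F J"
    and "block_LU_factorization (normal_index (\<lambda>j. s (j + 1))) J L U"
  shows "(\<lambda>z. z * F z + of_real (s 0)) \<in> D_minus \<and>
         gen_jacobi_matrix_of (\<lambda>z. z * F z + of_real (s 0)) (inf_mat_mult U L)"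
proof -
  define n where "n = normal_index (\<lambda>j. s (j + 1))"
  have F: "F \<in> nevanlinna"
    using assms(1) by (simp add: nevanlinna_inf_def)
  obtain s' \<sigma> P b c where s': "asymptotic_series F s'" and \<sigma>': "stieltjes_measure F s' \<sigma>"
    and P': "monic_orthogonal_polynomials (scale_measure (ennreal (1 / s' 0)) \<sigma>) P"
    and c: "\<forall>j. c j > 0"
    and rec: "\<forall>j. [:0, 1:] * P j = P (j + 1) + Polynomial.smult (b j) (P j) +
               (if j = 0 then 0 else Polynomial.smult (c (j - 1)) (P (j - 1)))"
    and J: "J = monic_jacobi_matrix b c"
    using assms(4) unfolding monic_jacobi_matrix_of_def by blast
  have "s' = s"
    by (rule asymptotic_series_unique[OF s' assms(3)])
  then have \<sigma>: "stieltjes_measure F s \<sigma>"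
    and P: "monic_orthogonal_polynomials (scale_measure (ennreal (1 / s 0)) \<sigma>) P"
    using \<sigma>' P' by simp_all
  define \<Lambda> where "\<Lambda> = (\<lambda>p. LINT t|\<sigma>. poly p t)"
  interpret orth: orthogonal_recurrence \<Lambda> P b c
    unfolding \<Lambda>_def by (rule orthogonal_recurrence_integral[OF \<sigma> F P c rec])
  have s: "s i = \<Lambda> (Polynomial.monom 1 i)" for i
  proof -
    have "poly (Polynomial.monom 1 i) = (\<lambda>t::real. t ^ i)"
      by (simp add: fun_eq_iff poly_monom)
    then show ?thesis
      using \<sigma> by (simp add: stieltjes_measure_def \<Lambda>_def)
  qed
  then have s_mm: "s = orth.mixed_moment 0"
    by (simp add: orth.mixed_moment_def orth.P_0 fun_eq_iff)
  have "strict_mono n"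
    unfolding n_def using orth.infinite_normal_indices by (intro normal_index_strict_mono) (simp add: s)
  moreover have "n 0 = 0"
    by (simp add: n_def normal_index_def)
  moreover obtain l u where
    "block_tridiagonal n (\<lambda>j. 1\<^sub>m (block_size n j)) (\<lambda>j. 0\<^sub>m (block_size n j) (block_size n (j + 1)))
       (\<lambda>j. upper_left (block_size n (j + 1)) (block_size n j) (l (j + 1))) L"
    "block_tridiagonal n (\<lambda>j. companion_block (block_size n j) (u j))
       (\<lambda>j. lower_left (block_size n j) (block_size n (j + 1)) 1)
       (\<lambda>j. 0\<^sub>m (block_size n (j + 1)) (block_size n j)) U"
    "J = inf_mat_mult L U"
    using assms(5) unfolding block_LU_factorization_def Let_def n_def by blast
  ultimately interpret orthogonal_block_LU \<Lambda> P b c n J L U l u F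
    using c J F assms(3) by unfold_locales (auto simp: nevanlinna_def s_mm)
  have first: "first_coeff (\<lambda>j. s (j + 1)) = \<rho> 0"
    using first_coeff_moments by (simp add: s_mm)
  have "(\<lambda>z. z * F z + of_real (s 0)) \<in> D_minus"
    using stieltjes_measure_mass_pos[OF \<sigma> F] by (intro D_minus_of_nevanlinna assms(1)) simp
  moreover have "\<not> rational_function (\<lambda>z. z * F z + of_real (s 0))"
    using assms(2) rational_function_of_mult_z by blast
  moreover have "asymptotic_series (\<lambda>z. z * F z + of_real (s 0)) (\<lambda>j. s (j + 1))"
    by (rule asymptotic_series_mult_z[OF assms(3)])
  moreover have "normalized_gen_jacobi_matrix_of
      (\<lambda>z. (z * F z + of_real (s 0)) / of_real \<bar>first_coeff (\<lambda>j. s (j + 1))\<bar>) (inf_mat_mult U L)"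
    unfolding first using normalized_gen_jacobi_matrix_UL unfolding transform_0[abs_def] by (simp add: n_def s_mm)
  ultimately show ?thesis
    unfolding gen_jacobi_matrix_of_def by blast
qed

end
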